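(* Let $\mathcal{F} =\{f_i\}_{i \in I}$ and $\mathcal{E} =\{e_j\}_{j \in G}$ be frame sequences in $H$, with canonical dual frame sequences $\{\tilde f_i\}_{i\in I}$ and $\{\tilde e_j\}_{j\in G}$, let $P_{\mathcal F}$ and $P_{\mathcal E}$ be the orthogonal projections of $H$ onto $\overline{\mathrm{span}}(\mathcal{F})$ and $\overline{\mathrm{span}}(\mathcal{E})$, and let $a \colon I \to G$ be a map. If $D^+(I,a) < \infty$ and $(\mathcal{F},a,\mathcal{E})$ has both $\ell^2$-column decay and $\ell^2$-row decay, then the following statements hold. (a) For every sequence of centers $c = (c_N)_{N \in \mathbf{N}}$ in $G$, $$\lim_{N \to \infty} \left[ \left(\frac1{|S_N(c_N)|} \sum_{j \in S_N(c_N)} \langle P_{\mathcal F} \tilde e_j, e_j\rangle\right) - \left(\frac{|I_N(c_N)|}{|S_N(c_N)|}\right) \left(\frac1{|I_N(c_N)|} \sum_{i \in I_N(c_N)} \langle P_{\mathcal E} f_i, \tilde f_i\rangle\right)\right] = 0.$$ (b) For every sequence of centers $c = (c_N)_{N \in \mathbf{N}}$ in $G$ and any free ultrafilter $p$ on $\mathbf{N}$, $$\mathcal{M}_{\mathcal F}(\mathcal{E};p,c) = D(p,c) \cdot \mathcal{M}_{\mathcal E}(\mathcal{F};p,c).$$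
   Context: $H$ is a separable Hilbert space and $I$ is a countable index set. $G = \prod_{i=1}^d a_i \mathbf{Z} \times \prod_{j=1}^e \mathbf{Z}_{n_j}$ (with $d \ge 1$, $a_i>0$, a countably infinite abelian group), equipped with $|g| = \sup\{|a_1 k_1|,\dots,|a_d k_d|,\delta(m_1),\dots,\delta(m_e)\}$ for $g=(a_1k_1,\dots,a_dk_d,m_1,\dots,m_e)$, where $\delta(0)=0$ and $\delta(m)=1$ for $m\neq 0$. For $N \in \mathbf{N}$ and $j\in G$ put $S_N(j) = \{k \in G : |k-j| \le N/2\}$ and $I_N(j) = a^{-1}(S_N(j))$. The upper density is $D^+(I,a) = \limsup_{N\to\infty} \sup_{j\in G} |I_N(j)|/|S_N(j)|$. For a free ultrafilter $p$ on $\mathbf{N}$ and $c=(c_N)$ in $G$, $D(p,c) = p\text{-}\lim_{N} |I_N(c_N)|/|S_N(c_N)|$, where $p\text{-}\lim$ denotes the limit along $p$. A frame sequence is a sequence that is a frame for its closed linear span; its canonical dual frame sequence is the canonical dual frame within that closed span (the image of the sequence under the inverse of its frame operator $Sf=\sum_i \langle f,f_i\rangle f_i$ on that span). $(\mathcal{F},a,\mathcal{E})$ has $\ell^2$-column decay if for every $\varepsilon>0$ there is an integer $N_\varepsilon>0$ such that for all $j\in G$, $\sum_{i\in I\setminus I_{N_\varepsilon}(j)} |\langle f_i,e_j\rangle|^2<\varepsilon$. It has $\ell^2$-row decay if for every $\varepsilon>0$ there is an integer $N_\varepsilon>0$ such that for all $i\in I$, $\sum_{j\in G\setminus S_{N_\varepsilon}(a(i))}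 |\langle f_i,e_j\rangle|^2<\varepsilon$. Relative measures: $$\mathcal{M}_{\mathcal E}(\mathcal{F};p,c) = p\text{-}\lim_{N} \frac1{|I_N(c_N)|}\sum_{i\in I_N(c_N)} \langle P_{\mathcal E} f_i,\tilde f_i\rangle, \qquad \mathcal{M}_{\mathcal F}(\mathcal{E};p,c) = p\text{-}\lim_{N} \frac1{|S_N(c_N)|}\sum_{j\in S_N(c_N)} \langle P_{\mathcal F} \tilde e_j,e_j\rangle.$$ An average over an empty set $I_N(c_N)$ is read as $0$. *)

theory Defs
  imports "HOL-Analysis.Analysis" "HOL-Algebra.Product_Groups"
begin

section \<open>Hilbert spaces over the real or complex numbers\<close>

text \<open>
  By the Gelfand--Mazur theorem every \<^class>\<open>real_normed_field\<close> is isomorphic to the real or the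
  complex numbers, so the class below admits exactly these two scalar fields.
  The axioms force the usual conjugation, since \<open>conjug z = \<bar>z\<bar>\<^sup>2 / z\<close> for nonzero \<open>z\<close>.
\<close>

class real_or_complex = real_normed_field + euclidean_space +
  fixes conjug :: "'a \<Rightarrow> 'a"
  assumes conjug_add: "conjug (x + y) = conjug x + conjug y"
    and mult_conjug: "z * conjug z = (norm z)\<^sup>2 *\<^sub>R 1"

instantiation real :: real_or_complex
begin
definition conjug_real :: "real \<Rightarrow> real" where "conjug_real x = x"
instance by standard (auto simp: conjug_real_def power2_eq_square)
end

instantiation complex :: real_or_complex
begin
definition conjug_complex :: "complex \<Rightarrow> complex" where "conjug_complex = cnj"
instance
proof
  fix x y z :: complex
  show "conjug (x + y) = conjug x + conjug y"
    by (simp add: conjug_complex_def)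
  show "z * conjug z = (norm z)\<^sup>2 *\<^sub>R 1"
    unfolding conjug_complex_def scaleR_conv_of_real mult_1_right
    by (metis complex_norm_square)
qed
end

text \<open>Completeness is part of the class \<^class>\<open>banach\<close>.\<close>

locale hilbert_space = vector_space smul
  for smul :: "'k::real_or_complex \<Rightarrow> 'h::banach \<Rightarrow> 'h" +
  fixes ip :: "'h \<Rightarrow> 'h \<Rightarrow> 'k"
  assumes smul_of_real: "smul (of_real r) x = r *\<^sub>R x"
    and ip_add_left: "ip (x + y) z = ip x z + ip y z"
    and ip_smul_left: "ip (smul c x) y = c * ip x y"
    and ip_conjug: "ip y x = conjug (ip x y)"
    and ip_self: "ip x x = of_real ((norm x)\<^sup>2)"

definition orth_proj :: "('h::banach \<Rightarrow> 'h \<Rightarrow> 'k::real_or_complex) \<Rightarrow> 'h set \<Rightarrow> 'h \<Rightarrow> 'h" where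
  "orth_proj ip V x = (THE y. y \<in> V \<and> (\<forall>z\<in>V. ip (x - y) z = 0))"


section \<open>Frame sequences\<close>

definition closed_span ::
    "('k::real_or_complex \<Rightarrow> 'h::banach \<Rightarrow> 'h) \<Rightarrow> 'i set \<Rightarrow> ('i \<Rightarrow> 'h) \<Rightarrow> 'h set" where
  "closed_span smul I f = closure (module.span smul (f ` I))"

definition frame_sequence ::
    "('k::real_or_complex \<Rightarrow> 'h::banach \<Rightarrow> 'h) \<Rightarrow> ('h \<Rightarrow> 'h \<Rightarrow> 'k) \<Rightarrow> 'i set \<Rightarrow> ('i \<Rightarrow> 'h) \<Rightarrow> bool" where
  "frame_sequence smul ip I f \<longleftrightarrow>
     (\<exists>A>0. \<exists>B>0. \<forall>x\<in>closed_span smul I f.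
        (\<lambda>i. (norm (ip x (f i)))\<^sup>2) summable_on I \<and>
        A * (norm x)\<^sup>2 \<le> (\<Sum>\<^sub>\<infinity>i\<in>I. (norm (ip x (f i)))\<^sup>2) \<and>
        (\<Sum>\<^sub>\<infinity>i\<in>I. (norm (ip x (f i)))\<^sup>2) \<le> B * (norm x)\<^sup>2)"

definition frame_operator ::
    "('k::real_or_complex \<Rightarrow> 'h::banach \<Rightarrow> 'h) \<Rightarrow> ('h \<Rightarrow> 'h \<Rightarrow> 'k) \<Rightarrow> 'i set \<Rightarrow> ('i \<Rightarrow> 'h) \<Rightarrow> 'h \<Rightarrow> 'h" where
  "frame_operator smul ip I f x = (\<Sum>\<^sub>\<infinity>i\<in>I. smul (ip x (f i)) (f i))"

definition canonical_dual ::
    "('k::real_or_complex \<Rightarrow> 'h::banach \<Rightarrow> 'h) \<Rightarrow> ('h \<Rightarrow> 'h \<Rightarrow> 'k) \<Rightarrow> 'i set \<Rightarrow> ('i \<Rightarrow> 'h) \<Rightarrow> 'i \<Rightarrow> 'h" where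
  "canonical_dual smul ip I f i =
     inv_into (closed_span smul I f) (frame_operator smul ip I f) (f i)"


section \<open>The index group\<close>

type_synonym index = "(nat \<Rightarrow> real) \<times> (nat \<Rightarrow> int)"

definition scaled_int_group :: "real \<Rightarrow> real monoid" where
  "scaled_int_group s = \<lparr>carrier = range (\<lambda>k::int. s * of_int k), monoid.mult = (+), one = 0\<rparr>"

definition index_group :: "nat \<Rightarrow> (nat \<Rightarrow> real) \<Rightarrow> nat \<Rightarrow> (nat \<Rightarrow> nat) \<Rightarrow> index monoid" where
  "index_group d \<alpha> r n =
     product_group {1..d} (\<lambda>i. scaled_int_group (\<alpha> i)) \<times>\<times>
     product_group {1..r} (\<lambda>j. integer_mod_group (n j))"

definition index_abs :: "nat \<Rightarrow> nat \<Rightarrow> index \<Rightarrow> real" where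
  "index_abs d r g =
     Max ((\<lambda>i. \<bar>fst g i\<bar>) ` {1..d} \<union> (\<lambda>j. if snd g j = 0 then 0 else 1) ` {1..r})"

definition S_box ::
    "nat \<Rightarrow> (nat \<Rightarrow> real) \<Rightarrow> nat \<Rightarrow> (nat \<Rightarrow> nat) \<Rightarrow> nat \<Rightarrow> index \<Rightarrow> index set" where
  "S_box d \<alpha> r n N j =
     (let G = index_group d \<alpha> r n
      in {k \<in> carrier G. index_abs d r (k \<otimes>\<^bsub>G\<^esub> inv\<^bsub>G\<^esub> j) \<le> real N / 2})"

definition I_box ::
    "nat \<Rightarrow> (nat \<Rightarrow> real) \<Rightarrow> nat \<Rightarrow> (nat \<Rightarrow> nat) \<Rightarrow> 'i set \<Rightarrow> ('i \<Rightarrow> index) \<Rightarrow> nat \<Rightarrow> index \<Rightarrow> 'i set" where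
  "I_box d \<alpha> r n I a N j = {i \<in> I. a i \<in> S_box d \<alpha> r n N j}"


section \<open>Density and decay\<close>

text \<open>The counting measure gives the value \<open>\<infinity>\<close> to infinite sets, unlike \<^const>\<open>card\<close>.\<close>

definition upper_density ::
    "nat \<Rightarrow> (nat \<Rightarrow> real) \<Rightarrow> nat \<Rightarrow> (nat \<Rightarrow> nat) \<Rightarrow> 'i set \<Rightarrow> ('i \<Rightarrow> index) \<Rightarrow> ennreal" where
  "upper_density d \<alpha> r n I a =
     limsup (\<lambda>N. SUP j\<in>carrier (index_group d \<alpha> r n).
       emeasure (count_space UNIV) (I_box d \<alpha> r n I a N j) / of_nat (card (S_box d \<alpha> r n N j)))"

definition column_decay ::
    "('h::banach \<Rightarrow> 'h \<Rightarrow> 'k::real_or_complex) \<Rightarrow> nat \<Rightarrow> (nat \<Rightarrow> real) \<Rightarrow> nat \<Rightarrow> (nat \<Rightarrow> nat) \<Rightarrow>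
     'i set \<Rightarrow> ('i \<Rightarrow> index) \<Rightarrow> ('i \<Rightarrow> 'h) \<Rightarrow> (index \<Rightarrow> 'h) \<Rightarrow> bool" where
  "column_decay ip d \<alpha> r n I a f e \<longleftrightarrow>
     (\<forall>\<epsilon>>0. \<exists>N>0. \<forall>j\<in>carrier (index_group d \<alpha> r n).
        (\<lambda>i. (norm (ip (f i) (e j)))\<^sup>2) summable_on (I - I_box d \<alpha> r n I a N j) \<and>
        (\<Sum>\<^sub>\<infinity>i\<in>I - I_box d \<alpha> r n I a N j. (norm (ip (f i) (e j)))\<^sup>2) < \<epsilon>)"

definition row_decay ::
    "('h::banach \<Rightarrow> 'h \<Rightarrow> 'k::real_or_complex) \<Rightarrow> nat \<Rightarrow> (nat \<Rightarrow> real) \<Rightarrow> nat \<Rightarrow> (nat \<Rightarrow> nat) \<Rightarrow>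
     'i set \<Rightarrow> ('i \<Rightarrow> index) \<Rightarrow> ('i \<Rightarrow> 'h) \<Rightarrow> (index \<Rightarrow> 'h) \<Rightarrow> bool" where
  "row_decay ip d \<alpha> r n I a f e \<longleftrightarrow>
     (\<forall>\<epsilon>>0. \<exists>N>0. \<forall>i\<in>I.
        (\<lambda>j. (norm (ip (f i) (e j)))\<^sup>2)
          summable_on (carrier (index_group d \<alpha> r n) - S_box d \<alpha> r n N (a i)) \<and>
        (\<Sum>\<^sub>\<infinity>j\<in>carrier (index_group d \<alpha> r n) - S_box d \<alpha> r n N (a i).
           (norm (ip (f i) (e j)))\<^sup>2) < \<epsilon>)"


section \<open>Ultrafilter limits and relative measures\<close>

text \<open>
  An ultrafilter is represented by the filter \<open>p\<close> whose members are the sets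
  \<open>A\<close> with \<open>eventually (\<lambda>n. n \<in> A) p\<close>; limits along \<open>p\<close> are then \<^term>\<open>Lim p\<close>.
\<close>

definition free_ultrafilter :: "nat filter \<Rightarrow> bool" where
  "free_ultrafilter p \<longleftrightarrow>
     p \<noteq> bot \<and>
     (\<forall>P. eventually P p \<or> eventually (\<lambda>n. \<not> P n) p) \<and>
     (\<forall>m. \<not> eventually (\<lambda>n. n = m) p)"

text \<open>The average over an empty set is \<open>0\<close>, as \<open>0 / 0 = 0\<close>.\<close>

definition average :: "'b set \<Rightarrow> ('b \<Rightarrow> 'k::real_or_complex) \<Rightarrow> 'k" where
  "average A u = 1 / of_nat (card A) * (\<Sum>x\<in>A. u x)"

text \<open>
  \<open>avg_measure_E\<close> averages \<open>\<langle>P\<^sub>E f\<^sub>i, f\<^sub>i\<^sup>~\<rangle>\<close> over \<open>I\<^sub>N(j)\<close>, and \<open>avg_measure_F\<close> averages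
  \<open>\<langle>P\<^sub>F e\<^sub>k\<^sup>~, e\<^sub>k\<rangle>\<close> over \<open>S\<^sub>N(j)\<close>.
\<close>

definition avg_measure_E ::
    "('k::real_or_complex \<Rightarrow> 'h::banach \<Rightarrow> 'h) \<Rightarrow> ('h \<Rightarrow> 'h \<Rightarrow> 'k) \<Rightarrow>
     nat \<Rightarrow> (nat \<Rightarrow> real) \<Rightarrow> nat \<Rightarrow> (nat \<Rightarrow> nat) \<Rightarrow>
     'i set \<Rightarrow> ('i \<Rightarrow> index) \<Rightarrow> ('i \<Rightarrow> 'h) \<Rightarrow> (index \<Rightarrow> 'h) \<Rightarrow> nat \<Rightarrow> index \<Rightarrow> 'k" where
  "avg_measure_E smul ip d \<alpha> r n I a f e N j =
     average (I_box d \<alpha> r n I a N j)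
       (\<lambda>i. ip (orth_proj ip (closed_span smul (carrier (index_group d \<alpha> r n)) e) (f i))
               (canonical_dual smul ip I f i))"

definition avg_measure_F ::
    "('k::real_or_complex \<Rightarrow> 'h::banach \<Rightarrow> 'h) \<Rightarrow> ('h \<Rightarrow> 'h \<Rightarrow> 'k) \<Rightarrow>
     nat \<Rightarrow> (nat \<Rightarrow> real) \<Rightarrow> nat \<Rightarrow> (nat \<Rightarrow> nat) \<Rightarrow>
     'i set \<Rightarrow> ('i \<Rightarrow> 'h) \<Rightarrow> (index \<Rightarrow> 'h) \<Rightarrow> nat \<Rightarrow> index \<Rightarrow> 'k" where
  "avg_measure_F smul ip d \<alpha> r n I f e N j =
     average (S_box d \<alpha> r n N j)
       (\<lambda>k. ip (orth_proj ip (closed_span smul I f)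
                  (canonical_dual smul ip (carrier (index_group d \<alpha> r n)) e k))
               (e k))"

text \<open>
  Using \<^const>\<open>card\<close> here is harmless when the upper density is finite, as all the sets
  \<open>I\<^sub>N(j)\<close> are then finite.
\<close>

definition density_ratio ::
    "nat \<Rightarrow> (nat \<Rightarrow> real) \<Rightarrow> nat \<Rightarrow> (nat \<Rightarrow> nat) \<Rightarrow> 'i set \<Rightarrow> ('i \<Rightarrow> index) \<Rightarrow> nat \<Rightarrow> index \<Rightarrow> real" where
  "density_ratio d \<alpha> r n I a N j =
     real (card (I_box d \<alpha> r n I a N j)) / real (card (S_box d \<alpha> r n N j))"

definition ultra_density ::
    "nat \<Rightarrow> (nat \<Rightarrow> real) \<Rightarrow> nat \<Rightarrow> (nat \<Rightarrow> nat) \<Rightarrow> 'i set \<Rightarrow> ('i \<Rightarrow> index) \<Rightarrow>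
     nat filter \<Rightarrow> (nat \<Rightarrow> index) \<Rightarrow> real" where
  "ultra_density d \<alpha> r n I a p c = Lim p (\<lambda>N. density_ratio d \<alpha> r n I a N (c N))"

definition rel_measure_E ::
    "('k::real_or_complex \<Rightarrow> 'h::banach \<Rightarrow> 'h) \<Rightarrow> ('h \<Rightarrow> 'h \<Rightarrow> 'k) \<Rightarrow>
     nat \<Rightarrow> (nat \<Rightarrow> real) \<Rightarrow> nat \<Rightarrow> (nat \<Rightarrow> nat) \<Rightarrow>
     'i set \<Rightarrow> ('i \<Rightarrow> index) \<Rightarrow> ('i \<Rightarrow> 'h) \<Rightarrow> (index \<Rightarrow> 'h) \<Rightarrow> nat filter \<Rightarrow> (nat \<Rightarrow> index) \<Rightarrow> 'k" where
  "rel_measure_E smul ip d \<alpha> r n I a f e p c =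
     Lim p (\<lambda>N. avg_measure_E smul ip d \<alpha> r n I a f e N (c N))"

definition rel_measure_F ::
    "('k::real_or_complex \<Rightarrow> 'h::banach \<Rightarrow> 'h) \<Rightarrow> ('h \<Rightarrow> 'h \<Rightarrow> 'k) \<Rightarrow>
     nat \<Rightarrow> (nat \<Rightarrow> real) \<Rightarrow> nat \<Rightarrow> (nat \<Rightarrow> nat) \<Rightarrow>
     'i set \<Rightarrow> ('i \<Rightarrow> 'h) \<Rightarrow> (index \<Rightarrow> 'h) \<Rightarrow> nat filter \<Rightarrow> (nat \<Rightarrow> index) \<Rightarrow> 'k" where
  "rel_measure_F smul ip d \<alpha> r n I f e p c =
     Lim p (\<lambda>N. avg_measure_F smul ip d \<alpha> r n I f e N (c N))"

end

theory Submission
  imports Defs "HOL-Real_Asymp.Real_Asymp"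
begin

text \<open>
  Both averages are partial sums of one doubly indexed array, \<open>m\<^sub>i\<^sub>j = \<langle>f\<^sub>i, e\<^sub>j\<rangle> \<langle>e\<^sub>j\<^sup>~, f\<^sub>i\<^sup>~\<rangle>\<close>. Expanding \<open>P\<^sub>F e\<^sub>j\<^sup>~\<close>
  in the frame sequence \<open>f\<close> gives \<open>\<langle>P\<^sub>F e\<^sub>j\<^sup>~, e\<^sub>j\<rangle> = \<Sum>\<^sub>i m\<^sub>i\<^sub>j\<close>, a column sum, and expanding \<open>P\<^sub>E f\<^sub>i\<close> in \<open>e\<^sup>~\<close> gives
  \<open>\<langle>P\<^sub>E f\<^sub>i, f\<^sub>i\<^sup>~\<rangle> = \<Sum>\<^sub>j m\<^sub>i\<^sub>j\<close>, a row sum. So part (a) compares the sum of the columns over \<open>S\<^sub>N(c\<^sub>N)\<close> with the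
  sum of the rows over \<open>I\<^sub>N(c\<^sub>N)\<close>, both divided by \<open>|S\<^sub>N(c\<^sub>N)|\<close>. The common part over \<open>I\<^sub>N \<times> S\<^sub>N\<close> cancels. What
  remains is small: by Cauchy--Schwarz, column and row decay of \<open>\<langle>f\<^sub>i, e\<^sub>j\<rangle>\<close> together with the square
  summability of \<open>\<langle>e\<^sub>j\<^sup>~, f\<^sub>i\<^sup>~\<rangle>\<close> make each overhang small for indices at distance at least \<open>M / 2\<close> from the
  boundary of the box, and the number of the remaining indices is \<open>o(|S\<^sub>N|)\<close>; for the rows this uses that
  finite upper density bounds the fibers of \<open>a\<close>. This is \<open>truncated_sums_exchange\<close>, with
  \<open>shell_ratio_tendsto_0\<close> for the thin shells and \<open>upper_density_finite_fibers\<close> for the fibers.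

  The two expansions, and the square-summability of dual coefficients, rest on the frame operator
  \<open>T x = \<Sum>\<^sub>i \<langle>x, f\<^sub>i\<rangle> f\<^sub>i\<close>, considered on the whole space. It maps the closed span onto itself
  (\<open>frame_operator_surj\<close>, by a contraction argument), and for each \<open>x\<close> there is a \<open>v\<close> in the closed span
  with \<open>P x = T v\<close> and \<open>\<langle>x, f\<^sub>i\<^sup>~\<rangle> = \<langle>v, f\<^sub>i\<rangle>\<close> (\<open>projection_via_frame_operator\<close>); existence of the orthogonal
  projection is part of this construction.

  Part (b) follows from (a): all sequences involved are bounded, hence converge along an ultrafilter,
  and a free ultrafilter is finer than the filter of cofinite sets.
\<close>

section \<open>Conjugation and inner products\<close>

lemma conjug_zero [simp]: "conjug (0::'k::real_or_complex) = 0"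
  using conjug_add[of "0::'k" 0] by simp

lemma conjug_eq_divide:
  fixes z :: "'k::real_or_complex"
  assumes "z \<noteq> 0"
  shows "conjug z = of_real ((norm z)\<^sup>2) / z"
  using mult_conjug[of z] assms by (simp add: scaleR_conv_of_real field_simps)

lemma conjug_mult: "conjug (x * y) = conjug x * conjug (y::'k::real_or_complex)"
  by (cases "x = 0"; cases "y = 0") (auto simp: conjug_eq_divide norm_mult power_mult_distrib)

lemma conjug_of_real [simp]: "conjug (of_real r) = (of_real r :: 'k::real_or_complex)"
  by (cases "r = 0") (auto simp: conjug_eq_divide power2_eq_square)

lemma norm_conjug [simp]: "norm (conjug z) = norm (z::'k::real_or_complex)"
  by (cases "z = 0") (auto simp: conjug_eq_divide norm_divide norm_mult power2_eq_square)

lemma conjug_conjug [simp]: "conjug (conjug z) = (z::'k::real_or_complex)"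
proof (cases "z = 0")
  case False
  then have "conjug z \<noteq> 0" by (metis norm_conjug norm_eq_zero)
  with False show ?thesis
    by (simp add: conjug_eq_divide[of "conjug z"]) (simp add: conjug_eq_divide[of z])
qed simp

lemma conjug_mult_self: "conjug z * z = of_real ((norm (z::'k::real_or_complex))\<^sup>2)"
  using mult_conjug[of z] by (simp add: scaleR_conv_of_real mult.commute)

lemma bounded_linear_conjug: "bounded_linear (conjug :: 'k::real_or_complex \<Rightarrow> 'k)"
proof (rule bounded_linear_intro[where K=1])
  show "conjug (x + y) = conjug x + conjug y" for x y :: 'k
    by (rule conjug_add)
  show "conjug (r *\<^sub>R x) = r *\<^sub>R conjug x" for r and x :: 'k
    by (simp add: scaleR_conv_of_real conjug_mult)
qed simp

lemma norm_sum_mult_le: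
  fixes u w :: "'i \<Rightarrow> 'k::real_normed_field"
  shows "norm (\<Sum>i\<in>J. u i * w i) \<le> sqrt (\<Sum>i\<in>J. (norm (u i))\<^sup>2) * sqrt (\<Sum>i\<in>J. (norm (w i))\<^sup>2)"
proof -
  have "norm (\<Sum>i\<in>J. u i * w i) \<le> (\<Sum>i\<in>J. \<bar>norm (u i)\<bar> * \<bar>norm (w i)\<bar>)"
    by (rule sum_norm_le) (simp add: norm_mult)
  also have "\<dots> \<le> L2_set (\<lambda>i. norm (u i)) J * L2_set (\<lambda>i. norm (w i)) J"
    by (rule L2_set_mult_ineq)
  finally show ?thesis by (simp add: L2_set_def)
qed

context hilbert_space
begin

lemma ip_add_right: "ip x (y + z) = ip x y + ip x z"
  by (metis ip_add_left ip_conjug conjug_add)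

lemma ip_smul_right: "ip x (smul c y) = conjug c * ip x y"
  by (metis ip_conjug ip_smul_left conjug_mult)

lemma ip_scaleR_left: "ip (r *\<^sub>R x) y = of_real r * ip x y"
  by (metis ip_smul_left smul_of_real)

lemma ip_scaleR_right: "ip x (r *\<^sub>R y) = of_real r * ip x y"
  by (metis ip_smul_right smul_of_real conjug_of_real)

lemma ip_zero_left [simp]: "ip 0 y = 0"
  using ip_scaleR_left[of 0] by simp

lemma ip_diff_left: "ip (x - y) z = ip x z - ip y z"
  using ip_add_left[of "x - y" y z] by simp

lemma ip_diff_right: "ip x (y - z) = ip x y - ip x z"
  using ip_add_right[of x "y - z" z] by simp

lemma ip_sum_left: "ip (\<Sum>i\<in>A. g i) y = (\<Sum>i\<in>A. ip (g i) y)"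
  by (induction A rule: infinite_finite_induct) (auto simp: ip_add_left)

lemma norm_ip_commute: "norm (ip x y) = norm (ip y x)"
  by (metis ip_conjug norm_conjug)

lemma norm_smul: "norm (smul c x) = norm c * norm x"
proof -
  have "(of_real ((norm (smul c x))\<^sup>2) :: 'k) = c * (conjug c * of_real ((norm x)\<^sup>2))"
    by (simp only: ip_self[symmetric] ip_smul_left ip_smul_right mult.left_commute)
  also have "\<dots> = of_real ((norm c * norm x)\<^sup>2)"
    using conjug_mult_self[of c]
    by (simp only: power_mult_distrib of_real_mult mult.assoc[symmetric] mult.commute[of c])
  finally show ?thesis
    by (simp only: of_real_eq_iff) simp
qed

text \<open>The inequality is \<open>0 \<le> \<parallel>\<parallel>y\<parallel>\<^sup>2 x - \<langle>x, y\<rangle> y\<parallel>\<^sup>2\<close>, expanded.\<close>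

lemma Cauchy_Schwarz_ip: "norm (ip x y) \<le> norm x * norm y"
proof (cases "y = 0")
  case True
  then show ?thesis
    by (metis ip_conjug ip_zero_left conjug_zero norm_zero mult_zero_right order_refl)
next
  case False
  let ?b = "(norm y)\<^sup>2" and ?c = "ip x y"
  let ?z = "?b *\<^sub>R x - smul ?c y"
  have yx: "ip y x = conjug ?c" by (rule ip_conjug)
  have "(of_real ((norm ?z)\<^sup>2) :: 'k) = of_real (?b * (?b * (norm x)\<^sup>2))
      - of_real ?b * (conjug ?c * ?c)"
    unfolding ip_self[symmetric, of ?z]
    by (simp add: ip_diff_left ip_diff_right ip_scaleR_left ip_scaleR_right ip_smul_left
        ip_smul_right ip_self[of x] ip_self[of y] yx algebra_simps)
  also have "\<dots> = of_real (?b * (?b * (norm x)\<^sup>2 - (norm ?c)\<^sup>2))"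
    by (simp only: conjug_mult_self right_diff_distrib of_real_diff of_real_mult)
  finally have "(norm ?z)\<^sup>2 = ?b * (?b * (norm x)\<^sup>2 - (norm ?c)\<^sup>2)"
    by (simp only: of_real_eq_iff)
  then have "0 \<le> ?b * (?b * (norm x)\<^sup>2 - (norm ?c)\<^sup>2)"
    by (metis zero_le_power2)
  then have "(norm ?c)\<^sup>2 \<le> (norm x * norm y)\<^sup>2"
    using False by (simp add: zero_le_mult_iff power_mult_distrib mult.commute)
  then show ?thesis
    by (rule power2_le_imp_le) simp
qed

lemma bounded_linear_ip_left: "bounded_linear (\<lambda>x. ip x y)"
proof (rule bounded_linear_intro[where K="norm y"])
  show "norm (ip x y) \<le> norm x * norm y" for x
    by (rule Cauchy_Schwarz_ip)
qed (auto simp: ip_add_left ip_scaleR_left scaleR_conv_of_real)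

lemma norm_diff_scaleR_squared:
  assumes "ip v u = of_real q"
  shows "(norm (u - t *\<^sub>R v))\<^sup>2 = (norm u)\<^sup>2 - 2 * t * q + t\<^sup>2 * (norm v)\<^sup>2"
proof -
  have uv: "ip u v = of_real q"
    using assms ip_conjug[of u v] by simp
  have "(of_real ((norm (u - t *\<^sub>R v))\<^sup>2) :: 'k) = of_real ((norm u)\<^sup>2 - 2 * t * q + t\<^sup>2 * (norm v)\<^sup>2)"
    unfolding ip_self[symmetric, of "u - _"]
    by (simp add: ip_diff_left ip_diff_right ip_scaleR_left ip_scaleR_right ip_self[of u] ip_self[of v] assms uv
        algebra_simps power2_eq_square)
  then show ?thesis by (simp only: of_real_eq_iff)
qed

section \<open>Closed spans\<close>


lemma closed_span_closed [simp]: "closed (closed_span smul I f)"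
  by (simp add: closed_span_def)

lemma closed_span_base: "i \<in> I \<Longrightarrow> f i \<in> closed_span smul I f"
  unfolding closed_span_def using closure_subset[of "span (f ` I)"] span_base by blast

lemma closed_span_zero: "0 \<in> closed_span smul I f"
  unfolding closed_span_def using closure_subset[of "span (f ` I)"] span_zero by blast

lemma closed_span_add:
  assumes "x \<in> closed_span smul I f" "y \<in> closed_span smul I f"
  shows "x + y \<in> closed_span smul I f"
proof -
  obtain s t where s: "\<And>m. s m \<in> span (f ` I)" "s \<longlonglongrightarrow> x"
    and t: "\<And>m. t m \<in> span (f ` I)" "t \<longlonglongrightarrow> y"
    using assms unfolding closed_span_def closure_sequential by metis
  have "(\<lambda>m. s m + t m) \<longlonglongrightarrow> x + y"
    using s t by (intro tendsto_add)
  with s(1) t(1) show ?thesis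
    unfolding closed_span_def closure_sequential
    by (intro exI[of _ "\<lambda>m. s m + t m"]) (simp add: span_add)
qed

lemma closed_span_smul:
  assumes "x \<in> closed_span smul I f"
  shows "smul c x \<in> closed_span smul I f"
proof -
  obtain s where s: "\<And>m. s m \<in> span (f ` I)" "s \<longlonglongrightarrow> x"
    using assms unfolding closed_span_def closure_sequential by metis
  have "(\<lambda>m. norm (smul c (s m - x))) \<longlonglongrightarrow> 0"
    using s(2) by (auto simp: norm_smul intro!: tendsto_mult_right_zero tendsto_norm_zero LIM_zero)
  then have "(\<lambda>m. smul c (s m)) \<longlonglongrightarrow> smul c x"
    by (simp add: tendsto_norm_zero_iff LIM_zero_iff scale_right_diff_distrib)
  with s(1) show ?thesis
    unfolding closed_span_def closure_sequential
    by (intro exI[of _ "\<lambda>m. smul c (s m)"]) (simp add: span_scale)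
qed

lemma closed_span_scaleR: "x \<in> closed_span smul I f \<Longrightarrow> r *\<^sub>R x \<in> closed_span smul I f"
  by (metis closed_span_smul smul_of_real)

lemma closed_span_diff:
  "x \<in> closed_span smul I f \<Longrightarrow> y \<in> closed_span smul I f \<Longrightarrow> x - y \<in> closed_span smul I f"
  using closed_span_add[of x I f "(-1) *\<^sub>R y"] closed_span_scaleR[of y I f "-1"] by simp

lemma closed_span_sum:
  "(\<And>i. i \<in> A \<Longrightarrow> g i \<in> closed_span smul I f) \<Longrightarrow> (\<Sum>i\<in>A. g i) \<in> closed_span smul I f"
  by (induction A rule: infinite_finite_induct) (auto simp: closed_span_zero closed_span_add)

lemma closed_span_has_sum:
  assumes "(g has_sum x) A" "\<And>i. i \<in> A \<Longrightarrow> g i \<in> closed_span smul I f"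
  shows "x \<in> closed_span smul I f"
proof (rule Lim_in_closed_set)
  show "(sum g \<longlongrightarrow> x) (finite_subsets_at_top A)"
    using assms(1) by (simp add: has_sum_def)
  show "\<forall>\<^sub>F F in finite_subsets_at_top A. sum g F \<in> closed_span smul I f"
    using assms(2) by (intro eventually_finite_subsets_at_top_weakI closed_span_sum) auto
qed simp_all

lemma ip_eq_zero_closed_span:
  assumes "\<And>i. i \<in> I \<Longrightarrow> ip w (f i) = 0" "z \<in> closed_span smul I f"
  shows "ip z w = 0"
proof -
  obtain s where s: "\<And>m. s m \<in> span (f ` I)" "s \<longlonglongrightarrow> z"
    using assms unfolding closed_span_def closure_sequential by metis
  have z0: "ip y w = 0" if "y \<in> span (f ` I)" for y
    using that
  proof (induction rule: span_induct_alt)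
    case (step c x y)
    then obtain i where i: "i \<in> I" "x = f i" by blast
    then have "ip x w = 0" using assms(1)[of i] ip_conjug[of x w] by simp
    with step show ?case by (simp add: ip_add_left ip_smul_left)
  qed simp
  have "(\<lambda>m. ip (s m) w) \<longlonglongrightarrow> ip z w"
    using bounded_linear.tendsto[OF bounded_linear_ip_left s(2)] .
  then show ?thesis
    using z0 s(1) by (simp add: LIMSEQ_const_iff)
qed

section \<open>Bessel sequences and the frame operator\<close>

text \<open>The Bessel inequality in its synthesis form. The frame inequality only concerns vectors of the
  closed span; a bound on finite linear combinations carries no such restriction, and it yields both
  the analysis bound on the whole space and the convergence of the series of the frame operator.\<close>

definition bessel :: "'i set \<Rightarrow> ('i \<Rightarrow> 'h) \<Rightarrow> real \<Rightarrow> bool" where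
  "bessel I f B \<longleftrightarrow> B > 0 \<and>
     (\<forall>J c. finite J \<longrightarrow> J \<subseteq> I \<longrightarrow>
        (norm (\<Sum>i\<in>J. smul (c i) (f i)))\<^sup>2 \<le> B * (\<Sum>i\<in>J. (norm (c i))\<^sup>2))"

text \<open>The vector \<open>y = \<Sum>\<^sub>J c\<^sub>i f\<^sub>i\<close> lies in the closed span, so the upper frame bound \<open>B\<close> applies to it:
  \<open>\<parallel>y\<parallel>\<^sup>2 = \<Sum>\<^sub>J c\<^sub>i \<langle>f\<^sub>i, y\<rangle> \<le> \<parallel>c\<parallel> (B \<parallel>y\<parallel>\<^sup>2)\<^sup>1\<^sup>/\<^sup>2\<close>.\<close>

lemma frame_sequence_imp_bessel:
  assumes "frame_sequence smul ip I f"
  obtains B where "bessel I f B"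
proof -
  obtain A B where "A > 0" and B: "B > 0"
    and fr: "\<forall>x\<in>closed_span smul I f. (\<lambda>i. (norm (ip x (f i)))\<^sup>2) summable_on I \<and>
        A * (norm x)\<^sup>2 \<le> (\<Sum>\<^sub>\<infinity>i\<in>I. (norm (ip x (f i)))\<^sup>2) \<and>
        (\<Sum>\<^sub>\<infinity>i\<in>I. (norm (ip x (f i)))\<^sup>2) \<le> B * (norm x)\<^sup>2"
    using assms unfolding frame_sequence_def by blast
  have "(norm (\<Sum>i\<in>J. smul (c i) (f i)))\<^sup>2 \<le> B * (\<Sum>i\<in>J. (norm (c i))\<^sup>2)"
    if J: "finite J" "J \<subseteq> I" for J c
  proof -
    let ?y = "\<Sum>i\<in>J. smul (c i) (f i)" and ?s = "\<Sum>i\<in>J. (norm (c i))\<^sup>2"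
    have y: "?y \<in> closed_span smul I f"
      using J by (intro closed_span_sum closed_span_smul closed_span_base) auto
    have "(\<Sum>i\<in>J. (norm (ip ?y (f i)))\<^sup>2) \<le> (\<Sum>\<^sub>\<infinity>i\<in>I. (norm (ip ?y (f i)))\<^sup>2)"
      by (rule finite_sum_le_infsum) (use J fr y in auto)
    also have "\<dots> \<le> B * (norm ?y)\<^sup>2" using fr y by blast
    finally have an: "(\<Sum>i\<in>J. (norm (ip (f i) ?y))\<^sup>2) \<le> B * (norm ?y)\<^sup>2"
      by (simp add: norm_ip_commute[of ?y])
    have "(norm ?y)\<^sup>2 = norm (ip ?y ?y)"
      by (simp only: ip_self norm_of_real abs_power2)
    also have "ip ?y ?y = (\<Sum>i\<in>J. c i * ip (f i) ?y)"
      by (simp add: ip_sum_left ip_smul_left)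
    also have "norm \<dots> \<le> sqrt ?s * sqrt (\<Sum>i\<in>J. (norm (ip (f i) ?y))\<^sup>2)"
      by (rule norm_sum_mult_le)
    also have "\<dots> \<le> sqrt ?s * sqrt (B * (norm ?y)\<^sup>2)"
      using an by (intro mult_left_mono) (auto intro!: sum_nonneg)
    also have "\<dots> = sqrt (B * ?s) * norm ?y"
      by (simp add: real_sqrt_mult)
    finally have "norm ?y \<le> sqrt (B * ?s)"
      by (cases "norm ?y = 0") (use B in \<open>auto simp: power2_eq_square intro!: sum_nonneg mult_nonneg_nonneg\<close>)
    then have "(norm ?y)\<^sup>2 \<le> (sqrt (B * ?s))\<^sup>2"
      by (intro power_mono) auto
    then show ?thesis
      using B by (simp add: sum_nonneg)
  qed
  with B that show ?thesis unfolding bessel_def by blast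
qed

lemma bessel_pos: "bessel I f B \<Longrightarrow> B > 0"
  by (simp add: bessel_def)

lemma bessel_le:
  assumes "bessel I f B" "finite J" "J \<subseteq> I"
  shows "(norm (\<Sum>i\<in>J. smul (c i) (f i)))\<^sup>2 \<le> B * (\<Sum>i\<in>J. (norm (c i))\<^sup>2)"
  using assms by (simp add: bessel_def)

text \<open>Duality: for finite \<open>J\<close> the sum \<open>s = \<Sum>\<^sub>J |\<langle>x, f\<^sub>i\<rangle>|\<^sup>2\<close> is the inner product of \<open>\<Sum>\<^sub>J \<langle>x, f\<^sub>i\<rangle> f\<^sub>i\<close> with \<open>x\<close>,
  hence at most \<open>(B s)\<^sup>1\<^sup>/\<^sup>2 \<parallel>x\<parallel>\<close>, for an arbitrary \<open>x\<close> of the space.\<close>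

lemma bessel_analysis:
  assumes "bessel I f B"
  shows "(\<lambda>i. (norm (ip x (f i)))\<^sup>2) summable_on I"
    and "(\<Sum>\<^sub>\<infinity>i\<in>I. (norm (ip x (f i)))\<^sup>2) \<le> B * (norm x)\<^sup>2"
proof -
  have fin: "(\<Sum>i\<in>J. (norm (ip x (f i)))\<^sup>2) \<le> B * (norm x)\<^sup>2" if J: "finite J" "J \<subseteq> I" for J
  proof -
    let ?s = "\<Sum>i\<in>J. (norm (ip x (f i)))\<^sup>2"
    let ?y = "\<Sum>i\<in>J. smul (ip x (f i)) (f i)"
    have s: "0 \<le> ?s" by (simp add: sum_nonneg)
    have "ip ?y x = of_real ?s"
      by (simp only: ip_sum_left ip_smul_left ip_conjug[of "f i" x for i] mult.commute[of "ip x (f i)" for i]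
          conjug_mult_self of_real_sum)
    then have "?s = norm (ip ?y x)" using s by (metis abs_of_nonneg norm_of_real)
    then have "?s \<le> norm ?y * norm x" using Cauchy_Schwarz_ip[of ?y x] by simp
    then have "?s\<^sup>2 \<le> (norm ?y)\<^sup>2 * (norm x)\<^sup>2"
      using s by (metis power_mono power_mult_distrib)
    also have "\<dots> \<le> (B * ?s) * (norm x)\<^sup>2"
      using bessel_le[OF assms J] by (intro mult_right_mono) auto
    finally have "?s * ?s \<le> (B * (norm x)\<^sup>2) * ?s"
      by (simp add: power2_eq_square mult_ac)
    then show ?thesis
      using s bessel_pos[OF assms] by (cases "?s = 0") auto
  qed
  show "(\<lambda>i. (norm (ip x (f i)))\<^sup>2) summable_on I"
    by (rule nonneg_bdd_above_summable_on) (auto intro!: bdd_aboveI2 fin)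
  then show "(\<Sum>\<^sub>\<infinity>i\<in>I. (norm (ip x (f i)))\<^sup>2) \<le> B * (norm x)\<^sup>2"
    using fin by (rule infsum_le_finite_sums)
qed

text \<open>The common hypothesis on a frame sequence and on its dual, with the inequality required for every
  vector of the space and not only for those of the closed span.\<close>

definition analysis_bound :: "'i set \<Rightarrow> ('i \<Rightarrow> 'h) \<Rightarrow> real \<Rightarrow> bool" where
  "analysis_bound I g C \<longleftrightarrow> C > 0 \<and> (\<forall>x. (\<lambda>i. (norm (ip x (g i)))\<^sup>2) summable_on I \<and>
     (\<Sum>\<^sub>\<infinity>i\<in>I. (norm (ip x (g i)))\<^sup>2) \<le> C * (norm x)\<^sup>2)"

lemma bessel_imp_analysis_bound: "bessel I f B \<Longrightarrow> analysis_bound I f B"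
  unfolding analysis_bound_def using bessel_analysis[of I f B] bessel_pos[of I f B] by simp

lemma analysis_bound_mono:
  assumes "analysis_bound I g C" "C \<le> C'"
  shows "analysis_bound I g C'"
proof -
  have "C * (norm x)\<^sup>2 \<le> C' * (norm x)\<^sup>2" for x :: 'h
    using assms(2) by (rule mult_right_mono) simp
  then show ?thesis
    using assms unfolding analysis_bound_def by (meson less_le_trans order_trans)
qed

lemma analysis_bound_norm:
  assumes "analysis_bound I g C" "i \<in> I"
  shows "(norm (g i))\<^sup>2 \<le> C"
proof -
  have "(\<Sum>j\<in>{i}. (norm (ip (g i) (g j)))\<^sup>2) \<le> (\<Sum>\<^sub>\<infinity>j\<in>I. (norm (ip (g i) (g j)))\<^sup>2)"
    by (rule finite_sum_le_infsum) (use assms in \<open>auto simp: analysis_bound_def\<close>)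
  also have "\<dots> \<le> C * (norm (g i))\<^sup>2"
    using assms by (simp add: analysis_bound_def)
  finally have "(norm (g i))\<^sup>2 * (norm (g i))\<^sup>2 \<le> C * (norm (g i))\<^sup>2"
    by (simp only: sum.insert sum.empty finite.emptyI empty_iff ip_self norm_of_real abs_power2
        power2_eq_square[of "(norm (g i))\<^sup>2"] not_False_eq_True add_0_right)
  then show ?thesis
    using assms mult_right_le_imp_le[of "(norm (g i))\<^sup>2" "(norm (g i))\<^sup>2" C]
    by (cases "g i = 0") (auto simp: analysis_bound_def)
qed

text \<open>The series need not converge absolutely, as the norms of its terms are only square-summable. Its
  finite partial sums are nevertheless Cauchy, since the Bessel inequality bounds the sum over a finite
  set of indices by the square sum of the coefficients there.\<close>

lemma bessel_synthesis_summable: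
  assumes "bessel I f B" and c: "(\<lambda>i. (norm (c i))\<^sup>2) summable_on I"
  shows "(\<lambda>i. smul (c i) (f i)) summable_on I"
proof -
  let ?g = "\<lambda>i. smul (c i) (f i)" and ?n = "\<lambda>i. (norm (c i))\<^sup>2"
  have B: "B > 0"
    using assms(1) by (rule bessel_pos)
  have bd: "\<And>J. finite J \<Longrightarrow> J \<subseteq> I \<Longrightarrow> (norm (sum ?g J))\<^sup>2 \<le> B * sum ?n J"
    using assms(1) by (rule bessel_le)
  have "\<exists>P. eventually P (finite_subsets_at_top I) \<and>
      (\<forall>F F'. P F \<and> P F' \<longrightarrow> dist (sum ?g F) (sum ?g F') < \<epsilon>)" if "\<epsilon> > 0" for \<epsilon>
  proof -
    define \<eta> where "\<eta> = (\<epsilon>/4)\<^sup>2 / B"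
    have \<eta>: "\<eta> > 0" using that B by (simp add: \<eta>_def)
    obtain F0 where F0: "finite F0" "F0 \<subseteq> I" "dist (sum ?n F0) (infsum ?n I) \<le> \<eta>"
      using infsum_finite_approximation[OF c \<eta>] by blast
    have near: "norm (sum ?g F - sum ?g F0) \<le> \<epsilon>/4" if F: "finite F" "F0 \<subseteq> F" "F \<subseteq> I" for F
    proof -
      have "sum ?n F \<le> infsum ?n I"
        by (rule finite_sum_le_infsum) (use c F in auto)
      then have "sum ?n (F - F0) \<le> \<eta>"
        using F0 F by (simp add: sum_diff dist_real_def)
      then have "(norm (sum ?g (F - F0)))\<^sup>2 \<le> B * \<eta>"
        using bd[of "F - F0"] F B by (smt (verit) Diff_subset finite_Diff mult_left_mono order_trans)
      also have "\<dots> = (\<epsilon>/4)\<^sup>2" using B by (simp add: \<eta>_def)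
      finally have "norm (sum ?g (F - F0)) \<le> \<epsilon>/4"
        by (rule power2_le_imp_le) (use \<open>\<epsilon> > 0\<close> in simp)
      then show ?thesis using F F0 by (simp add: sum_diff)
    qed
    let ?P = "\<lambda>F. finite F \<and> F0 \<subseteq> F \<and> F \<subseteq> I"
    have "eventually ?P (finite_subsets_at_top I)"
      unfolding eventually_finite_subsets_at_top using F0 by blast
    moreover have "dist (sum ?g F) (sum ?g F') < \<epsilon>" if "?P F" "?P F'" for F F'
    proof -
      have "dist (sum ?g F) (sum ?g F') \<le> norm (sum ?g F - sum ?g F0) + norm (sum ?g F' - sum ?g F0)"
        unfolding dist_norm[symmetric] by (rule dist_triangle2)
      also have "\<dots> \<le> \<epsilon>/4 + \<epsilon>/4" using near that by (intro add_mono) auto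
      finally show ?thesis using \<open>\<epsilon> > 0\<close> by simp
    qed
    ultimately show ?thesis by (intro exI[of _ ?P]) simp
  qed
  then have "cauchy_filter (filtermap (sum ?g) (finite_subsets_at_top I))"
    by (simp add: cauchy_filter_metric_filtermap)
  moreover have "complete (UNIV::'h set)"
    by (rule complete_UNIV)
  ultimately obtain L where "(sum ?g \<longlongrightarrow> L) (finite_subsets_at_top I)"
    using complete_uniform[where S=UNIV] by (force simp add: filterlim_def)
  then show ?thesis
    using summable_on_def has_sum_def by blast
qed

lemma frame_operator_has_sum:
  assumes "bessel I f B"
  shows "((\<lambda>i. smul (ip x (f i)) (f i)) has_sum frame_operator smul ip I f x) I"
  unfolding frame_operator_def
  using bessel_synthesis_summable[OF assms bessel_analysis(1)[OF assms]] by simp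

lemma ip_frame_operator_has_sum:
  assumes "bessel I f B"
  shows "((\<lambda>i. ip x (f i) * ip (f i) y) has_sum ip (frame_operator smul ip I f x) y) I"
  using has_sum_bounded_linear[OF bounded_linear_ip_left frame_operator_has_sum[OF assms]]
  by (simp add: ip_smul_left)

lemma ip_frame_operator_adjoint:
  assumes "bessel I f B"
  shows "ip (frame_operator smul ip I f x) y = ip x (frame_operator smul ip I f y)"
proof -
  have "((\<lambda>i. conjug (ip y (f i) * ip (f i) x)) has_sum conjug (ip (frame_operator smul ip I f y) x)) I"
    by (rule has_sum_bounded_linear[OF bounded_linear_conjug ip_frame_operator_has_sum[OF assms]])
  then have "((\<lambda>i. ip x (f i) * ip (f i) y) has_sum ip x (frame_operator smul ip I f y)) I"
    by (simp add: conjug_mult ip_conjug[symmetric] mult.commute)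
  then show ?thesis
    using ip_frame_operator_has_sum[OF assms] has_sum_unique by blast
qed

lemma ip_frame_operator_self:
  assumes "bessel I f B"
  shows "ip (frame_operator smul ip I f x) x = of_real (\<Sum>\<^sub>\<infinity>i\<in>I. (norm (ip x (f i)))\<^sup>2)"
proof -
  have "((\<lambda>i. of_real ((norm (ip x (f i)))\<^sup>2) :: 'k) has_sum of_real (\<Sum>\<^sub>\<infinity>i\<in>I. (norm (ip x (f i)))\<^sup>2)) I"
    using bessel_analysis(1)[OF assms] by (intro has_sum_of_real) simp
  then have "((\<lambda>i. ip x (f i) * ip (f i) x) has_sum of_real (\<Sum>\<^sub>\<infinity>i\<in>I. (norm (ip x (f i)))\<^sup>2)) I"
    by (simp only: conjug_mult_self[symmetric] ip_conjug[symmetric] mult.commute)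
  then show ?thesis
    using ip_frame_operator_has_sum[OF assms] has_sum_unique by blast
qed

lemma frame_operator_in_closed_span:
  assumes "bessel I f B"
  shows "frame_operator smul ip I f x \<in> closed_span smul I f"
  by (rule closed_span_has_sum[OF frame_operator_has_sum[OF assms]])
    (auto intro: closed_span_smul closed_span_base)

lemma frame_operator_diff:
  assumes "bessel I f B"
  shows "frame_operator smul ip I f (x - y) = frame_operator smul ip I f x - frame_operator smul ip I f y"
proof -
  have "((\<lambda>i. smul (ip (x - y) (f i)) (f i)) has_sum
      (frame_operator smul ip I f x + (- 1) *\<^sub>R frame_operator smul ip I f y)) I"
    using has_sum_add[OF frame_operator_has_sum[OF assms]
        has_sum_bounded_linear[OF bounded_linear_scaleR_right[of "-1"] frame_operator_has_sum[OF assms]]]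
    by (simp add: ip_diff_left scale_left_diff_distrib)
  then show ?thesis
    using frame_operator_has_sum[OF assms, of "x - y"] has_sum_unique by fastforce
qed

lemma norm_frame_operator_le:
  assumes "bessel I f B"
  shows "norm (frame_operator smul ip I f x) \<le> B * norm x"
proof -
  let ?y = "frame_operator smul ip I f x"
  have B: "B > 0" using assms by (rule bessel_pos)
  have "(norm ?y)\<^sup>2 \<le> (B * norm x)\<^sup>2"
  proof (rule tendsto_upperbound)
    show "((\<lambda>J. (norm (\<Sum>i\<in>J. smul (ip x (f i)) (f i)))\<^sup>2) \<longlongrightarrow> (norm ?y)\<^sup>2) (finite_subsets_at_top I)"
      using frame_operator_has_sum[OF assms, of x] unfolding has_sum_def by (intro tendsto_intros)
    have "(norm (\<Sum>i\<in>J. smul (ip x (f i)) (f i)))\<^sup>2 \<le> (B * norm x)\<^sup>2" if J: "finite J" "J \<subseteq> I" for J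
    proof -
      have "(norm (\<Sum>i\<in>J. smul (ip x (f i)) (f i)))\<^sup>2 \<le> B * (\<Sum>i\<in>J. (norm (ip x (f i)))\<^sup>2)"
        using assms J by (rule bessel_le)
      also have "\<dots> \<le> B * (B * (norm x)\<^sup>2)"
        using B finite_sum_le_infsum[OF bessel_analysis(1)[OF assms], of J x] J bessel_analysis(2)[OF assms, of x]
        by (intro mult_left_mono) auto
      finally show ?thesis by (simp add: power2_eq_square mult_ac)
    qed
    then show "\<forall>\<^sub>F J in finite_subsets_at_top I.
        (norm (\<Sum>i\<in>J. smul (ip x (f i)) (f i)))\<^sup>2 \<le> (B * norm x)\<^sup>2"
      by (intro eventually_finite_subsets_at_top_weakI)
  qed simp
  then show ?thesis
    by (rule power2_le_imp_le) (use B in simp)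
qed

section \<open>Canonical duals and orthogonal projections\<close>

text \<open>With \<open>T\<close> the frame operator, a preimage of \<open>y\<close> is a fixed point of \<open>x \<mapsto> x - t (T x - y)\<close> on the closed span. As
  \<open>\<langle>T u, u\<rangle> \<ge> A \<parallel>u\<parallel>\<^sup>2\<close> and \<open>\<parallel>T u\<parallel> \<le> B \<parallel>u\<parallel>\<close>, expanding the norm gives
  \<open>\<parallel>u - t T u\<parallel>\<^sup>2 \<le> (1 - 2 t A + t\<^sup>2 B\<^sup>2) \<parallel>u\<parallel>\<^sup>2\<close>, and \<open>t = A / B\<^sup>2\<close> minimizes the factor, with value
  \<open>1 - (A / B)\<^sup>2 < 1\<close>.\<close>

lemma frame_operator_surj:
  assumes fr: "frame_sequence smul ip I f" and y: "y \<in> closed_span smul I f"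
  shows "y \<in> frame_operator smul ip I f ` closed_span smul I f"
proof -
  let ?V = "closed_span smul I f" and ?T = "frame_operator smul ip I f"
  obtain A where A: "A > 0"
    and low: "\<forall>x\<in>?V. A * (norm x)\<^sup>2 \<le> (\<Sum>\<^sub>\<infinity>i\<in>I. (norm (ip x (f i)))\<^sup>2)"
    using fr unfolding frame_sequence_def by blast
  obtain B0 where B0: "bessel I f B0"
    using frame_sequence_imp_bessel[OF fr] .
  \<comment> \<open>For the zero space a lower frame bound may exceed an upper one, which would make \<open>\<rho>\<close> meaningless.\<close>
  define B where "B = max A B0"
  have B: "B > 0" "A \<le> B" using A by (auto simp: B_def)
  have le: "norm (?T x) \<le> B * norm x" for x
    using norm_frame_operator_le[OF B0, of x] mult_right_mono[of B0 B "norm x"] by (auto simp: B_def)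
  define t where "t = A / B\<^sup>2"
  define \<rho> where "\<rho> = sqrt (1 - (A / B)\<^sup>2)"
  have AB: "0 < A / B" "A / B \<le> 1" using A B by auto
  have \<rho>: "0 \<le> \<rho>" "\<rho> < 1"
    using AB by (auto simp: \<rho>_def power_le_one)
  have contract: "norm (u - t *\<^sub>R ?T u) \<le> \<rho> * norm u" if "u \<in> ?V" for u
  proof -
    let ?q = "\<Sum>\<^sub>\<infinity>i\<in>I. (norm (ip u (f i)))\<^sup>2"
    have "(norm (u - t *\<^sub>R ?T u))\<^sup>2 = (norm u)\<^sup>2 - 2 * t * ?q + t\<^sup>2 * (norm (?T u))\<^sup>2"
      by (rule norm_diff_scaleR_squared[OF ip_frame_operator_self[OF B0]])
    also have "\<dots> \<le> (norm u)\<^sup>2 - 2 * t * (A * (norm u)\<^sup>2) + t\<^sup>2 * (B * norm u)\<^sup>2"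
      using bspec[OF low that] A le[of u]
      by (intro add_mono diff_mono mult_left_mono power_mono) (auto simp: t_def)
    also have "\<dots> = (1 - (A / B)\<^sup>2) * (norm u)\<^sup>2"
      using B by (simp add: t_def field_simps power2_eq_square)
    also have "\<dots> = (\<rho> * norm u)\<^sup>2"
      using AB by (simp add: \<rho>_def power_mult_distrib power_le_one)
    finally show ?thesis
      by (rule power2_le_imp_le) (use \<rho> in simp)
  qed
  have "\<exists>!x\<in>?V. x - t *\<^sub>R (?T x - y) = x"
  proof (rule Banach_fix[OF _ _ \<rho>])
    show "complete ?V" by (simp add: complete_eq_closed)
    show "?V \<noteq> {}" using closed_span_zero by blast
    show "(\<lambda>x. x - t *\<^sub>R (?T x - y)) ` ?V \<subseteq> ?V"
      using y frame_operator_in_closed_span[OF B0] by (auto intro!: closed_span_diff closed_span_scaleR)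
    show "dist (x - t *\<^sub>R (?T x - y)) (x' - t *\<^sub>R (?T x' - y)) \<le> \<rho> * dist x x'"
      if "x \<in> ?V" "x' \<in> ?V" for x x'
      using contract[OF closed_span_diff[OF that]]
      by (simp add: dist_norm frame_operator_diff[OF B0] algebra_simps)
  qed
  then obtain x where "x \<in> ?V" "t *\<^sub>R (?T x - y) = 0"
    by auto
  moreover have "t \<noteq> 0" using A B by (simp add: t_def)
  ultimately show ?thesis by auto
qed

lemma canonical_dual:
  assumes "frame_sequence smul ip I f" "i \<in> I"
  shows "canonical_dual smul ip I f i \<in> closed_span smul I f"
    and "frame_operator smul ip I f (canonical_dual smul ip I f i) = f i"
  unfolding canonical_dual_def
  using frame_operator_surj[OF assms(1) closed_span_base[OF assms(2)]]
  by (auto intro: inv_into_into f_inv_into_f)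

lemma orth_proj_eqI:
  assumes "y \<in> closed_span smul I f" "\<And>z. z \<in> closed_span smul I f \<Longrightarrow> ip (x - y) z = 0"
  shows "orth_proj ip (closed_span smul I f) x = y"
  unfolding orth_proj_def
proof (rule the_equality)
  fix y' assume y': "y' \<in> closed_span smul I f \<and> (\<forall>z\<in>closed_span smul I f. ip (x - y') z = 0)"
  have "ip (y' - y) (y' - y) = ip (x - y) (y' - y) - ip (x - y') (y' - y)"
    by (simp add: ip_diff_left)
  also have "\<dots> = 0"
    using y' assms closed_span_diff[of y' I f y] by simp
  finally show "y' = y" by (simp add: ip_self)
qed (use assms in blast)

text \<open>Twofold inversion of the frame operator \<open>T\<close> on the closed span. With \<open>T w = T x\<close>, the vector
  \<open>x - w\<close> is annihilated by \<open>T\<close> and so is orthogonal to every \<open>f\<^sub>i\<close>; hence \<open>w\<close> is the projection of \<open>x\<close>.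
  With \<open>T v = w\<close>, self-adjointness of \<open>T\<close> gives \<open>\<langle>v, f\<^sub>i\<rangle> = \<langle>v, T f\<^sub>i\<^sup>~\<rangle> = \<langle>w, f\<^sub>i\<^sup>~\<rangle> = \<langle>x, f\<^sub>i\<^sup>~\<rangle>\<close>.
  So dual coefficients of \<open>x\<close> are ordinary coefficients of \<open>v\<close>, and every statement about the dual
  sequence reduces to one about the sequence itself.\<close>

lemma projection_via_frame_operator:
  assumes fr: "frame_sequence smul ip I f"
  obtains v where "v \<in> closed_span smul I f"
    and "orth_proj ip (closed_span smul I f) x = frame_operator smul ip I f v"
    and "\<And>z. z \<in> closed_span smul I f \<Longrightarrow> ip (x - frame_operator smul ip I f v) z = 0"
    and "\<And>i. i \<in> I \<Longrightarrow> ip x (canonical_dual smul ip I f i) = ip v (f i)"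
proof -
  let ?V = "closed_span smul I f" and ?T = "frame_operator smul ip I f"
  obtain B where B: "bessel I f B"
    using frame_sequence_imp_bessel[OF fr] .
  obtain w where w: "w \<in> ?V" "?T w = ?T x"
    using frame_operator_surj[OF fr frame_operator_in_closed_span[OF B, of x]] by auto
  obtain v where v: "v \<in> ?V" "?T v = w"
    using frame_operator_surj[OF fr w(1)] by auto
  have "?T (x - w) = 0" using w by (simp add: frame_operator_diff[OF B])
  then have "(of_real (\<Sum>\<^sub>\<infinity>i\<in>I. (norm (ip (x - w) (f i)))\<^sup>2) :: 'k) = 0"
    using ip_frame_operator_self[OF B, of "x - w"] by simp
  then have sum0: "(\<Sum>\<^sub>\<infinity>i\<in>I. (norm (ip (x - w) (f i)))\<^sup>2) = 0"
    by (simp only: of_real_eq_0_iff)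
  have "ip (x - w) (f i) = 0" if "i \<in> I" for i
  proof -
    have "(norm (ip (x - w) (f i)))\<^sup>2 = 0"
      by (rule nonneg_infsum_le_0D[OF _ bessel_analysis(1)[OF B] _ that]) (use sum0 in auto)
    then show ?thesis by simp
  qed
  then have perp: "ip (x - w) z = 0" if "z \<in> ?V" for z
    using ip_eq_zero_closed_span[OF _ that, of "x - w"] ip_conjug[of "x - w" z] by simp
  have "ip x (canonical_dual smul ip I f i) = ip v (f i)" if "i \<in> I" for i
  proof -
    have "ip v (f i) = ip v (?T (canonical_dual smul ip I f i))"
      using canonical_dual(2)[OF fr that] by simp
    also have "\<dots> = ip w (canonical_dual smul ip I f i)"
      using ip_frame_operator_adjoint[OF B, of v] v by simp
    also have "\<dots> = ip x (canonical_dual smul ip I f i)"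
      using perp[OF canonical_dual(1)[OF fr that]] by (simp add: ip_diff_left)
    finally show ?thesis by simp
  qed
  with that[of v] show ?thesis
    using v orth_proj_eqI[OF w(1) perp] perp by auto
qed

text \<open>With \<open>v\<close> as in \<open>projection_via_frame_operator\<close>, the projection of \<open>x\<close> is \<open>T v = \<Sum>\<^sub>i \<langle>v, f\<^sub>i\<rangle> f\<^sub>i\<close>, and \<open>\<langle>v, f\<^sub>i\<rangle> = \<langle>x, f\<^sub>i\<^sup>~\<rangle>\<close>.\<close>

lemma canonical_dual_expansion:
  assumes fr: "frame_sequence smul ip I f"
  shows "((\<lambda>i. ip x (canonical_dual smul ip I f i) * ip (f i) y) has_sum
           ip (orth_proj ip (closed_span smul I f) x) y) I"
proof -
  obtain B where B: "bessel I f B"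
    using frame_sequence_imp_bessel[OF fr] .
  obtain v where v: "orth_proj ip (closed_span smul I f) x = frame_operator smul ip I f v"
      "\<And>i. i \<in> I \<Longrightarrow> ip x (canonical_dual smul ip I f i) = ip v (f i)"
    using projection_via_frame_operator[OF fr] by metis
  show ?thesis
    using ip_frame_operator_has_sum[OF B, of v y] v(2)
    by (subst v(1)) (simp cong: has_sum_cong)
qed

lemma orth_proj_adjoint:
  assumes fr: "frame_sequence smul ip I f"
  shows "ip (orth_proj ip (closed_span smul I f) x) y = conjug (ip (orth_proj ip (closed_span smul I f) y) x)"
proof -
  obtain B where B: "bessel I f B"
    using frame_sequence_imp_bessel[OF fr] .
  let ?V = "closed_span smul I f" and ?P = "orth_proj ip (closed_span smul I f)"
  have in_V: "?P x \<in> ?V" and perp: "z \<in> ?V \<Longrightarrow> ip (x - ?P x) z = 0" for x z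
    using projection_via_frame_operator[OF fr, of x] frame_operator_in_closed_span[OF B] by metis+
  have "ip (?P x) y = conjug (ip y (?P x))" by (rule ip_conjug)
  also have "ip y (?P x) = ip (?P y) (?P x)"
    using perp[OF in_V, of y x] by (simp add: ip_diff_left)
  also have "\<dots> = conjug (ip (?P x) (?P y))" by (rule ip_conjug)
  also have "ip (?P x) (?P y) = ip x (?P y)"
    using perp[OF in_V, of x y] by (simp add: ip_diff_left)
  also have "\<dots> = conjug (ip (?P y) x)" by (rule ip_conjug)
  finally show ?thesis by simp
qed

text \<open>The same expansion with the roles of the sequence and its dual exchanged. Each of the two forms is
  needed once: the main argument expands the projection of a dual vector of one frame sequence and
  the projection of a primal vector of the other.\<close>

lemma canonical_dual_expansion':
  assumes fr: "frame_sequence smul ip I f"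
  shows "((\<lambda>i. ip x (f i) * ip (canonical_dual smul ip I f i) y) has_sum
           ip (orth_proj ip (closed_span smul I f) x) y) I"
  using has_sum_bounded_linear[OF bounded_linear_conjug canonical_dual_expansion[OF fr, of y x]]
  by (simp add: orth_proj_adjoint[OF fr, of x y] conjug_mult ip_conjug[symmetric] mult.commute)

text \<open>With \<open>v\<close> as in \<open>projection_via_frame_operator\<close>,
  \<open>\<Sum>\<^sub>i |\<langle>x, f\<^sub>i\<^sup>~\<rangle>|\<^sup>2 = \<Sum>\<^sub>i |\<langle>v, f\<^sub>i\<rangle>|\<^sup>2 = \<langle>T v, v\<rangle> = \<langle>x, v\<rangle>\<close>, and the lower frame bound \<open>A\<close> at \<open>v\<close>
  turns this into at most \<open>\<parallel>x\<parallel>\<^sup>2 / A\<close>.\<close>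

lemma canonical_dual_analysis_bound:
  assumes fr: "frame_sequence smul ip I f"
  obtains C where "analysis_bound I (canonical_dual smul ip I f) C"
proof -
  let ?V = "closed_span smul I f" and ?T = "frame_operator smul ip I f"
  let ?D = "\<lambda>x i. (norm (ip x (canonical_dual smul ip I f i)))\<^sup>2"
  obtain A where A: "A > 0"
    and low: "\<forall>x\<in>?V. A * (norm x)\<^sup>2 \<le> (\<Sum>\<^sub>\<infinity>i\<in>I. (norm (ip x (f i)))\<^sup>2)"
    using fr unfolding frame_sequence_def by blast
  obtain B where B: "bessel I f B"
    using frame_sequence_imp_bessel[OF fr] .
  have *: "?D x summable_on I \<and> infsum (?D x) I \<le> (1 / A) * (norm x)\<^sup>2" for x
  proof -
    obtain v where v: "v \<in> ?V" "\<And>z. z \<in> ?V \<Longrightarrow> ip (x - ?T v) z = 0"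
      "\<And>i. i \<in> I \<Longrightarrow> ip x (canonical_dual smul ip I f i) = ip v (f i)"
      using projection_via_frame_operator[OF fr] by metis
    let ?q = "\<Sum>\<^sub>\<infinity>i\<in>I. (norm (ip v (f i)))\<^sup>2"
    have D: "?D x summable_on I" "infsum (?D x) I = ?q"
      using bessel_analysis(1)[OF B, of v] v(3) by (simp_all cong: summable_on_cong infsum_cong)
    have q0: "0 \<le> ?q" by (rule infsum_nonneg) simp
    have "of_real ?q = ip x v"
      using ip_frame_operator_self[OF B, of v] v(2)[OF v(1)] by (simp add: ip_diff_left)
    then have "?q \<le> norm x * norm v"
      using Cauchy_Schwarz_ip[of x v] q0 by (metis abs_of_nonneg norm_of_real)
    then have "?q\<^sup>2 \<le> (norm x)\<^sup>2 * (norm v)\<^sup>2"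
      using q0 by (metis power_mono power_mult_distrib)
    also have "\<dots> \<le> (norm x)\<^sup>2 * (?q / A)"
      using bspec[OF low v(1)] A by (intro mult_left_mono) (auto simp: field_simps)
    finally have "?q * ?q \<le> ((1 / A) * (norm x)\<^sup>2) * ?q"
      by (simp add: power2_eq_square)
    then have "?q \<le> (1 / A) * (norm x)\<^sup>2"
      using q0 A by (cases "?q = 0") (auto simp del: times_divide_eq_left)
    with D show ?thesis by simp
  qed
  show ?thesis
    by (rule that[of "1 / A"]) (use * A in \<open>simp add: analysis_bound_def\<close>)
qed

end

section \<open>Boxes in the index group\<close>

lemma group_scaled_int_group: "group (scaled_int_group s)"
proof (rule groupI)
  fix x y assume "x \<in> carrier (scaled_int_group s)" "y \<in> carrier (scaled_int_group s)"
  then obtain k l :: int where "x = s * of_int k" "y = s * of_int l"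
    by (auto simp: scaled_int_group_def)
  then have "x + y = s * of_int (k + l)" by (simp add: distrib_left)
  then have "x + y \<in> range (\<lambda>k::int. s * of_int k)" by blast
  then show "x \<otimes>\<^bsub>scaled_int_group s\<^esub> y \<in> carrier (scaled_int_group s)"
    by (simp add: scaled_int_group_def)
next
  show "\<one>\<^bsub>scaled_int_group s\<^esub> \<in> carrier (scaled_int_group s)"
    by (auto simp: scaled_int_group_def image_iff intro: exI[of _ 0])
next
  fix x assume "x \<in> carrier (scaled_int_group s)"
  then obtain k :: int where "x = s * of_int k"
    by (auto simp: scaled_int_group_def)
  then have "- x = s * of_int (- k)" by simp
  then have "- x \<in> carrier (scaled_int_group s)"
    unfolding scaled_int_group_def by (auto simp del: of_int_minus)
  then show "\<exists>y\<in>carrier (scaled_int_group s). y \<otimes>\<^bsub>scaled_int_group s\<^esub> x = \<one>\<^bsub>scaled_int_group s\<^esub>"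
    by (intro bexI[of _ "- x"]) (auto simp: scaled_int_group_def)
qed (auto simp: scaled_int_group_def)

lemma inv_scaled_int_group:
  assumes "x \<in> carrier (scaled_int_group s)"
  shows "inv\<^bsub>scaled_int_group s\<^esub> x = - x"
proof (rule group.inv_equality[OF group_scaled_int_group _ assms])
  obtain k :: int where "x = s * of_int k"
    using assms by (auto simp: scaled_int_group_def)
  then have "- x = s * of_int (- k)" by simp
  then show "- x \<in> carrier (scaled_int_group s)"
    unfolding scaled_int_group_def by (auto simp del: of_int_minus)
qed (simp add: scaled_int_group_def)

lemma card_scaled_interval:
  fixes s :: real and m :: int
  assumes "s > 0"
  shows "finite {x \<in> range (\<lambda>k::int. s * of_int k). \<bar>x - s * of_int m\<bar> \<le> t}"
    and "t \<ge> 0 \<Longrightarrow> card {x \<in> range (\<lambda>k::int. s * of_int k). \<bar>x - s * of_int m\<bar> \<le> t} = nat (2 * \<lfloor>t / s\<rfloor> + 1)"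
proof -
  have iff: "\<bar>s * of_int k - s * of_int m\<bar> \<le> t \<longleftrightarrow> k \<in> {m - \<lfloor>t / s\<rfloor>..m + \<lfloor>t / s\<rfloor>}" for k
  proof -
    have "\<bar>s * of_int k - s * of_int m\<bar> = s * of_int \<bar>k - m\<bar>"
      using assms by (simp add: abs_mult flip: right_diff_distrib)
    then have "\<bar>s * of_int k - s * of_int m\<bar> \<le> t \<longleftrightarrow> of_int \<bar>k - m\<bar> \<le> t / s"
      using assms by (simp add: field_simps)
    also have "\<dots> \<longleftrightarrow> \<bar>k - m\<bar> \<le> \<lfloor>t / s\<rfloor>"
      by (simp only: le_floor_iff)
    finally show ?thesis by auto
  qed
  have eq: "{x \<in> range (\<lambda>k::int. s * of_int k). \<bar>x - s * of_int m\<bar> \<le> t} =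
      (\<lambda>k. s * of_int k) ` {m - \<lfloor>t / s\<rfloor>..m + \<lfloor>t / s\<rfloor>}"
  proof (rule Set.set_eqI)
    fix x
    show "x \<in> {x \<in> range (\<lambda>k::int. s * of_int k). \<bar>x - s * of_int m\<bar> \<le> t} \<longleftrightarrow>
        x \<in> (\<lambda>k. s * of_int k) ` {m - \<lfloor>t / s\<rfloor>..m + \<lfloor>t / s\<rfloor>}"
      unfolding mem_Collect_eq image_iff using iff by blast
  qed
  show "finite {x \<in> range (\<lambda>k::int. s * of_int k). \<bar>x - s * of_int m\<bar> \<le> t}"
    unfolding eq by simp
  have "inj_on (\<lambda>k::int. s * of_int k) A" for A
    using assms by (auto simp: inj_on_def)
  then show "card {x \<in> range (\<lambda>k::int. s * of_int k). \<bar>x - s * of_int m\<bar> \<le> t} = nat (2 * \<lfloor>t / s\<rfloor> + 1)"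
    unfolding eq by (simp add: card_image)
qed

text \<open>After multiplication by \<open>s\<close>, numerator and denominator are within \<open>s\<close> of \<open>N - M\<close> and of \<open>N\<close>.\<close>

lemma side_ratio_tendsto:
  fixes s :: real and M :: nat
  assumes "s > 0"
  shows "(\<lambda>N. real_of_int (2 * \<lfloor>real (N - M) / 2 / s\<rfloor> + 1) / real_of_int (2 * \<lfloor>real N / 2 / s\<rfloor> + 1))
    \<longlonglongrightarrow> 1"
proof (rule tendsto_sandwich)
  show "\<forall>\<^sub>F N in sequentially. (real N - real M - s) / (real N + s)
      \<le> real_of_int (2 * \<lfloor>real (N - M) / 2 / s\<rfloor> + 1) / real_of_int (2 * \<lfloor>real N / 2 / s\<rfloor> + 1)"
    using eventually_ge_at_top[of "M + nat \<lceil>s\<rceil>"]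
  proof eventually_elim
    case (elim N)
    let ?x = "\<lfloor>real (N - M) / 2 / s\<rfloor>" and ?y = "\<lfloor>real N / 2 / s\<rfloor>"
    have lower: "real N - real M - s \<le> s * (2 * x + 1)" if "real (N - M) / 2 / s \<le> x + 1" for x
      using that assms elim by (simp add: field_simps of_nat_diff)
    have upper: "s * (2 * y + 1) \<le> real N + s" if "y \<le> real N / 2 / s" for y
      using that assms by (simp add: field_simps)
    have "real N - real M - s \<le> s * (2 * real_of_int ?x + 1)" by (rule lower) linarith
    moreover have "s * (2 * real_of_int ?y + 1) \<le> real N + s" by (rule upper) linarith
    moreover have "0 < s * (2 * real_of_int ?y + 1)"
    proof (rule mult_pos_pos[OF assms])
      have "0 \<le> ?y" using assms by simp
      then show "0 < 2 * real_of_int ?y + 1" by linarith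
    qed
    moreover have "0 \<le> real N - real M - s" using elim by linarith
    ultimately have "(real N - real M - s) / (real N + s) \<le> (s * (2 * ?x + 1)) / (s * (2 * ?y + 1))"
      using assms by (intro frac_le) auto
    then show ?case using assms by simp
  qed
  show "\<forall>\<^sub>F N in sequentially. real_of_int (2 * \<lfloor>real (N - M) / 2 / s\<rfloor> + 1)
      / real_of_int (2 * \<lfloor>real N / 2 / s\<rfloor> + 1) \<le> 1"
  proof (rule always_eventually, rule allI)
    fix N :: nat
    have "\<lfloor>real (N - M) / 2 / s\<rfloor> \<le> \<lfloor>real N / 2 / s\<rfloor>"
      using assms by (intro floor_mono divide_right_mono) auto
    moreover have "0 \<le> \<lfloor>real N / 2 / s\<rfloor>" using assms by simp
    ultimately show "real_of_int (2 * \<lfloor>real (N - M) / 2 / s\<rfloor> + 1)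
      / real_of_int (2 * \<lfloor>real N / 2 / s\<rfloor> + 1) \<le> 1"
      by (subst divide_le_eq_1_pos) linarith+
  qed
  show "(\<lambda>N. (real N - real M - s) / (real N + s)) \<longlonglongrightarrow> 1"
    by real_asymp
qed simp

locale index_setting =
  fixes d r :: nat and \<alpha> :: "nat \<Rightarrow> real" and n :: "nat \<Rightarrow> nat"
  assumes d_pos: "d \<ge> 1"
    and \<alpha>_pos: "\<And>i. i \<in> {1..d} \<Longrightarrow> \<alpha> i > 0"
    and n_pos: "\<And>j. j \<in> {1..r} \<Longrightarrow> n j > 0"
begin

abbreviation "G \<equiv> carrier (index_group d \<alpha> r n)"
abbreviation "S \<equiv> S_box d \<alpha> r n"

lemma index_group_carrier:
  "G = (\<Pi>\<^sub>E i\<in>{1..d}. range (\<lambda>k::int. \<alpha> i * of_int k)) \<times> (\<Pi>\<^sub>E j\<in>{1..r}. {0..<int (n j)})"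
proof -
  have "(\<Pi>\<^sub>E j\<in>{1..r}. carrier (integer_mod_group (n j))) = (\<Pi>\<^sub>E j\<in>{1..r}. {0..<int (n j)})"
    using n_pos by (intro PiE_cong) (auto simp: carrier_integer_mod_group)
  then show ?thesis by (simp add: index_group_def scaled_int_group_def)
qed

text \<open>This reduces the group structure to coordinates. In a torsion factor the difference of two residues
  vanishes only if they are equal, as both are taken from \<open>{0..<n\<^sub>i}\<close>.\<close>

lemma index_abs_le_iff:
  assumes j: "j \<in> G" and k: "k \<in> G" and t: "t \<ge> 0"
  shows "index_abs d r (k \<otimes>\<^bsub>index_group d \<alpha> r n\<^esub> inv\<^bsub>index_group d \<alpha> r n\<^esub> j) \<le> t \<longleftrightarrow>
    (\<forall>i\<in>{1..d}. \<bar>fst k i - fst j i\<bar> \<le> t) \<and> (\<forall>i\<in>{1..r}. snd k i \<noteq> snd j i \<longrightarrow> 1 \<le> t)"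
proof -
  let ?A = "product_group {1..d} (\<lambda>i. scaled_int_group (\<alpha> i))"
    and ?B = "product_group {1..r} (\<lambda>j. integer_mod_group (n j))"
  let ?x = "k \<otimes>\<^bsub>index_group d \<alpha> r n\<^esub> inv\<^bsub>index_group d \<alpha> r n\<^esub> j"
  have grp: "group ?A" "group ?B"
    by (simp_all add: group_scaled_int_group)
  have j': "fst j \<in> (\<Pi>\<^sub>E i\<in>{1..d}. carrier (scaled_int_group (\<alpha> i)))"
    "snd j \<in> (\<Pi>\<^sub>E i\<in>{1..r}. carrier (integer_mod_group (n i)))"
    using j by (auto simp: index_group_def)
  have "inv\<^bsub>?A \<times>\<times> ?B\<^esub> (fst j, snd j) = (inv\<^bsub>?A\<^esub> fst j, inv\<^bsub>?B\<^esub> snd j)"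
    using grp j' by (intro inv_DirProd) auto
  then have x: "?x = (fst k \<otimes>\<^bsub>?A\<^esub> inv\<^bsub>?A\<^esub> fst j, snd k \<otimes>\<^bsub>?B\<^esub> inv\<^bsub>?B\<^esub> snd j)"
    unfolding index_group_def by (simp add: mult_DirProd')
  have x1: "fst ?x i = fst k i - fst j i" if "i \<in> {1..d}" for i
  proof -
    have "fst j i \<in> carrier (scaled_int_group (\<alpha> i))" using j'(1) that by (rule PiE_mem)
    then have "inv\<^bsub>scaled_int_group (\<alpha> i)\<^esub> (fst j i) = - fst j i" by (rule inv_scaled_int_group)
    then show ?thesis
      using that j'(1) by (simp add: x group_scaled_int_group) (simp add: scaled_int_group_def)
  qed
  have x2: "snd ?x i = 0 \<longleftrightarrow> snd k i = snd j i" if i: "i \<in> {1..r}" for i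
  proof -
    have ji: "snd j i \<in> carrier (integer_mod_group (n i))" using j'(2) i by (rule PiE_mem)
    have "snd ?x i = (snd k i + (- snd j i) mod int (n i)) mod int (n i)"
      using i j'(2) ji by (simp add: x)
    also have "\<dots> = (snd k i - snd j i) mod int (n i)"
      by (simp add: mod_add_right_eq)
    finally have "snd ?x i = 0 \<longleftrightarrow> int (n i) dvd snd k i - snd j i"
      by (simp add: dvd_eq_mod_eq_0)
    also have "\<dots> \<longleftrightarrow> snd k i = snd j i"
    proof -
      have "snd k i \<in> {0..<int (n i)}" "snd j i \<in> {0..<int (n i)}"
        using j k i unfolding index_group_carrier by (auto simp: PiE_iff)
      then show ?thesis
        by (metis (no_types, lifting) atLeastLessThan_iff mod_eq_dvd_iff mod_pos_pos_trivial)
    qed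
    finally show ?thesis .
  qed
  have "index_abs d r ?x \<le> t \<longleftrightarrow>
      (\<forall>y\<in>(\<lambda>i. \<bar>fst ?x i\<bar>) ` {1..d} \<union> (\<lambda>j. if snd ?x j = 0 then 0 else 1) ` {1..r}. y \<le> t)"
    unfolding index_abs_def using d_pos by (intro Max_le_iff) auto
  also have "\<dots> \<longleftrightarrow> (\<forall>i\<in>{1..d}. \<bar>fst ?x i\<bar> \<le> t) \<and> (\<forall>i\<in>{1..r}. snd ?x i \<noteq> 0 \<longrightarrow> 1 \<le> t)"
    using t by auto
  also have "\<dots> \<longleftrightarrow> (\<forall>i\<in>{1..d}. \<bar>fst k i - fst j i\<bar> \<le> t) \<and> (\<forall>i\<in>{1..r}. snd k i \<noteq> snd j i \<longrightarrow> 1 \<le> t)"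
    using x1 x2 by auto
  finally show ?thesis .
qed

lemma mem_S_box:
  assumes "j \<in> G"
  shows "k \<in> S N j \<longleftrightarrow> k \<in> G \<and> (\<forall>i\<in>{1..d}. \<bar>fst k i - fst j i\<bar> \<le> real N / 2) \<and>
    (\<forall>i\<in>{1..r}. snd k i \<noteq> snd j i \<longrightarrow> 2 \<le> N)"
  using index_abs_le_iff[OF assms, of k "real N / 2"]
  unfolding S_box_def Let_def by auto

lemma S_box_subset: "S N j \<subseteq> G"
  by (auto simp: S_box_def Let_def)

lemma S_box_self: "j \<in> G \<Longrightarrow> j \<in> S N j"
  by (simp add: mem_S_box)

lemma S_box_mono: "j \<in> G \<Longrightarrow> M \<le> N \<Longrightarrow> S M j \<subseteq> S N j"
  by (force simp: mem_S_box)

lemma S_box_trans: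
  assumes c: "c \<in> G" and j: "j \<in> S M c" and k: "k \<in> S N j"
  shows "k \<in> S (M + N) c"
proof -
  have j': "j \<in> G" using j S_box_subset by blast
  have "\<bar>fst k i - fst c i\<bar> \<le> real (M + N) / 2" if "i \<in> {1..d}" for i
  proof -
    have "\<bar>fst k i - fst j i\<bar> \<le> real N / 2" "\<bar>fst j i - fst c i\<bar> \<le> real M / 2"
      using that j k by (simp_all add: mem_S_box c j')
    then show ?thesis by (simp only: of_nat_add add_divide_distrib)
  qed
  moreover have "2 \<le> M + N" if "i \<in> {1..r}" "snd k i \<noteq> snd c i" for i
    using that j k by (cases "snd k i = snd j i") (auto simp: mem_S_box c j')
  ultimately show ?thesis
    using k by (simp add: mem_S_box c j')
qed

lemma S_box_nested:
  assumes "c \<in> G" "M \<le> N" "j \<in> S (N - M) c"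
  shows "S M j \<subseteq> S N c"
  using S_box_trans[OF assms(1,3), of _ M] assms(2) by auto

text \<open>In a torsion coordinate a difference contributes \<open>1\<close> to the size, so it is either forbidden (for
  \<open>N < 2\<close>) or unrestricted (for \<open>N \<ge> 2\<close>).\<close>

lemma S_box_product:
  assumes "j \<in> G"
  shows "S N j =
    (\<Pi>\<^sub>E i\<in>{1..d}. {x \<in> range (\<lambda>k::int. \<alpha> i * of_int k). \<bar>x - fst j i\<bar> \<le> real N / 2}) \<times>
    (\<Pi>\<^sub>E i\<in>{1..r}. if N \<ge> 2 then {0..<int (n i)} else {snd j i})"
  using assms unfolding set_eq_iff mem_S_box[OF assms]
  by (auto simp: index_group_carrier PiE_iff split: if_splits)

lemma S_box_card:
  assumes "j \<in> G"
  shows "finite (S N j)"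
    and "card (S N j) = (\<Prod>i\<in>{1..d}. nat (2 * \<lfloor>real N / 2 / \<alpha> i\<rfloor> + 1)) *
      (\<Prod>i\<in>{1..r}. if N \<ge> 2 then n i else 1)"
proof -
  have "\<exists>m::int. fst j i = \<alpha> i * of_int m" if "i \<in> {1..d}" for i
  proof -
    have "fst j i \<in> range (\<lambda>k::int. \<alpha> i * of_int k)"
      using assms that by (auto simp: index_group_carrier PiE_iff)
    then show ?thesis by blast
  qed
  then obtain m :: "nat \<Rightarrow> int" where m: "\<And>i. i \<in> {1..d} \<Longrightarrow> fst j i = \<alpha> i * of_int (m i)"
    by metis
  let ?X = "\<lambda>i. {x \<in> range (\<lambda>k::int. \<alpha> i * of_int k). \<bar>x - fst j i\<bar> \<le> real N / 2}"
    and ?Y = "\<lambda>i. if N \<ge> 2 then {0..<int (n i)} else {snd j i}"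
  have X: "finite (?X i)" "card (?X i) = nat (2 * \<lfloor>real N / 2 / \<alpha> i\<rfloor> + 1)" if "i \<in> {1..d}" for i
    using card_scaled_interval[OF \<alpha>_pos[OF that], where m = "m i" and t = "real N / 2"]
    by (simp_all add: m[OF that])
  have Y: "finite (?Y i)" "card (?Y i) = (if N \<ge> 2 then n i else 1)" for i
    by auto
  show "finite (S N j)"
    unfolding S_box_product[OF assms] using X(1) Y(1) by (intro finite_cartesian_product finite_PiE) auto
  show "card (S N j) = (\<Prod>i\<in>{1..d}. nat (2 * \<lfloor>real N / 2 / \<alpha> i\<rfloor> + 1)) *
      (\<Prod>i\<in>{1..r}. if N \<ge> 2 then n i else 1)"
    unfolding S_box_product[OF assms] card_cartesian_product
    by (simp only: card_PiE finite_atLeastAtMost) (intro arg_cong2[where f="(*)"] prod.cong refl X Y)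
qed

lemma S_box_card_pos: "j \<in> G \<Longrightarrow> card (S N j) > 0"
  using S_box_self S_box_card(1) card_gt_0_iff by blast

text \<open>For large \<open>N\<close> the quotient \<open>|S\<^sub>N\<^sub>-\<^sub>M(c)| / |S\<^sub>N(c)|\<close> is a finite product of ratios
  \<open>(2 \<lfloor>(N - M) / 2\<alpha>\<^sub>i\<rfloor> + 1) / (2 \<lfloor>N / 2\<alpha>\<^sub>i\<rfloor> + 1)\<close>; the torsion factors cancel once \<open>N - M \<ge> 2\<close>.
  The ratios do not involve \<open>c\<close>, so moving centers are no obstacle.\<close>

lemma shell_ratio_tendsto_0:
  assumes c: "\<And>N. c N \<in> G"
  shows "(\<lambda>N. real (card (S N (c N) - S (N - M) (c N))) / real (card (S N (c N)))) \<longlonglongrightarrow> 0"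
proof -
  let ?R = "\<lambda>i N. real_of_int (2 * \<lfloor>real (N - M) / 2 / \<alpha> i\<rfloor> + 1) / real_of_int (2 * \<lfloor>real N / 2 / \<alpha> i\<rfloor> + 1)"
  have "(\<lambda>N. 1 - (\<Prod>i\<in>{1..d}. ?R i N)) \<longlonglongrightarrow> 1 - (\<Prod>i\<in>{1..d}. 1)"
    using side_ratio_tendsto \<alpha>_pos by (intro tendsto_diff tendsto_const tendsto_prod) auto
  then have lim: "(\<lambda>N. 1 - (\<Prod>i\<in>{1..d}. ?R i N)) \<longlonglongrightarrow> 0" by simp
  have "\<forall>\<^sub>F N in sequentially. 1 - (\<Prod>i\<in>{1..d}. ?R i N) =
      real (card (S N (c N) - S (N - M) (c N))) / real (card (S N (c N)))"
    using eventually_ge_at_top[of "M + 2"]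
  proof eventually_elim
    case (elim N)
    let ?t = "\<Prod>i\<in>{1..r}. n i"
    have "?t > 0" using n_pos by (intro prod_pos) auto
    then have t: "real ?t > 0" by (simp only: of_nat_0_less_iff)
    have card_S: "real (card (S K (c N))) = (\<Prod>i\<in>{1..d}. real_of_int (2 * \<lfloor>real K / 2 / \<alpha> i\<rfloor> + 1)) * real ?t"
      if "K \<ge> 2" for K
    proof -
      have "real (nat (2 * \<lfloor>real K / 2 / \<alpha> i\<rfloor> + 1)) = real_of_int (2 * \<lfloor>real K / 2 / \<alpha> i\<rfloor> + 1)"
        if "i \<in> {1..d}" for i
        using \<alpha>_pos[OF that] by (intro of_nat_nat) simp
      then have "(\<Prod>i\<in>{1..d}. real (nat (2 * \<lfloor>real K / 2 / \<alpha> i\<rfloor> + 1))) =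
          (\<Prod>i\<in>{1..d}. real_of_int (2 * \<lfloor>real K / 2 / \<alpha> i\<rfloor> + 1))"
        by (intro prod.cong refl)
      then show ?thesis
        unfolding S_box_card(2)[OF c] using that by simp
    qed
    have pos: "real (card (S N (c N))) > 0" using S_box_card_pos[OF c] by simp
    have "real (card (S (N - M) (c N))) / real (card (S N (c N))) = (\<Prod>i\<in>{1..d}. ?R i N)"
    proof -
      have K: "N - M \<ge> 2" "N \<ge> 2" using elim by simp_all
      have t0: "real ?t \<noteq> 0" using t by (rule less_imp_neq[symmetric])
      show ?thesis
        by (simp only: card_S[OF K(1)] card_S[OF K(2)] mult_divide_mult_cancel_right[OF t0] prod_dividef)
    qed
    moreover have "real (card (S N (c N) - S (N - M) (c N))) =
        real (card (S N (c N))) - real (card (S (N - M) (c N)))"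
    proof -
      have sub: "S (N - M) (c N) \<subseteq> S N (c N)" using S_box_mono[OF c] by simp
      then show ?thesis
        using card_mono[OF S_box_card(1)[OF c] sub] S_box_card(1)[OF c] finite_subset
        by (subst card_Diff_subset) (auto simp: of_nat_diff)
    qed
    ultimately show ?case using pos by (simp add: diff_divide_distrib)
  qed
  from Lim_transform_eventually[OF lim this] show ?thesis .
qed

text \<open>A point \<open>j\<close> of \<open>G\<close> lies in its own box, so a bound on all \<open>|I\<^sub>N(j)|\<close> for one single \<open>N\<close> already bounds
  the fibers of \<open>a\<close>; such an \<open>N\<close> exists as the limit superior is finite and \<open>|S\<^sub>N(j)|\<close> is independent
  of \<open>j\<close>.\<close>

lemma upper_density_finite_fibers:
  assumes dens: "upper_density d \<alpha> r n I a < \<infinity>"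
  obtains K where "\<And>j. j \<in> G \<Longrightarrow> finite {i \<in> I. a i = j}" "\<And>j. j \<in> G \<Longrightarrow> card {i \<in> I. a i = j} \<le> K"
proof -
  let ?J = "I_box d \<alpha> r n I a"
  let ?s = "\<lambda>N. SUP j\<in>G. emeasure (count_space UNIV) (?J N j) / of_nat (card (S N j))"
  have "\<exists>N. ?s N < \<infinity>"
  proof (rule ccontr)
    assume "\<nexists>N. ?s N < \<infinity>"
    then have "?s N = \<infinity>" for N
      using less_top[of "?s N"] unfolding infinity_ennreal_def by blast
    then have "?s = (\<lambda>_. \<infinity>)" by (rule ext)
    then have "limsup ?s = \<infinity>" by (simp only: Limsup_const[OF sequentially_bot])
    with dens show False by (simp add: upper_density_def)
  qed
  then obtain N where N: "?s N < \<infinity>" by blast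
  obtain C where C: "?s N \<le> ennreal C" "C \<ge> 0"
  proof (cases "?s N" rule: ennreal_cases)
    case (real C)
    with that show ?thesis by (metis order_refl)
  next
    case top
    with N show ?thesis by (simp only: infinity_ennreal_def order.irrefl)
  qed
  define c where "c = real ((\<Prod>i\<in>{1..d}. nat (2 * \<lfloor>real N / 2 / \<alpha> i\<rfloor> + 1)) *
      (\<Prod>i\<in>{1..r}. if N \<ge> 2 then n i else 1))"
  have *: "finite (?J N j) \<and> real (card (?J N j)) \<le> C * c" if j: "j \<in> G" for j
  proof -
    have cj: "real (card (S N j)) = c"
      unfolding c_def S_box_card(2)[OF j] ..
    have c: "c > 0"
      unfolding cj[symmetric] of_nat_0_less_iff by (rule S_box_card_pos[OF j])
    have "emeasure (count_space UNIV) (?J N j) / of_nat (card (S N j)) \<le> ennreal C"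
      using C(1) by (rule order_trans[OF SUP_upper[OF j]])
    then have "emeasure (count_space UNIV) (?J N j) / ennreal c \<le> ennreal C"
      by (simp only: cj[symmetric] ennreal_of_nat_eq_real_of_nat)
    then have "emeasure (count_space UNIV) (?J N j) / ennreal c * ennreal c \<le> ennreal C * ennreal c"
      by (rule mult_right_mono) simp
    then have *: "emeasure (count_space UNIV) (?J N j) \<le> ennreal C * ennreal c"
      using c by (simp add: ennreal_divide_times)
    have fin: "finite (?J N j)"
    proof (rule ccontr)
      assume "infinite (?J N j)"
      then have "\<infinity> \<le> ennreal (C * c)"
        using * C c by (simp add: ennreal_mult)
      then show False by (simp add: top_unique)
    qed
    then have "ennreal (real (card (?J N j))) \<le> ennreal (C * c)"
      using * C c by (simp add: ennreal_mult ennreal_of_nat_eq_real_of_nat)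
    then have "real (card (?J N j)) \<le> C * c"
      using C c by (subst (asm) ennreal_le_iff) auto
    with fin show ?thesis by simp
  qed
  have sub: "{i \<in> I. a i = j} \<subseteq> ?J N j" if "j \<in> G" for j
    using S_box_self[OF that] by (auto simp: I_box_def)
  show ?thesis
  proof (rule that)
    show "finite {i \<in> I. a i = j}" if "j \<in> G" for j
      using *[OF that] sub[OF that] finite_subset by blast
    show "card {i \<in> I. a i = j} \<le> nat \<lceil>C * c\<rceil>" if "j \<in> G" for j
      using card_mono[OF _ sub[OF that]] *[OF that] by linarith
  qed
qed

end

lemma card_preimage_le:
  fixes a :: "'i \<Rightarrow> 'g"
  assumes "finite X" "\<And>j. j \<in> X \<Longrightarrow> finite {i \<in> I. a i = j}" "\<And>j. j \<in> X \<Longrightarrow> card {i \<in> I. a i = j} \<le> K"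
  shows "finite {i \<in> I. a i \<in> X}" "card {i \<in> I. a i \<in> X} \<le> K * card X"
proof -
  have eq: "{i \<in> I. a i \<in> X} = (\<Union>j\<in>X. {i \<in> I. a i = j})" by auto
  show "finite {i \<in> I. a i \<in> X}" unfolding eq using assms by blast
  have "card {i \<in> I. a i \<in> X} \<le> (\<Sum>j\<in>X. card {i \<in> I. a i = j})"
    unfolding eq by (rule card_UN_le[OF assms(1)])
  also have "\<dots> \<le> (\<Sum>j\<in>X. K)" using assms(3) by (rule sum_mono)
  finally show "card {i \<in> I. a i \<in> X} \<le> K * card X" by (simp add: mult.commute)
qed

section \<open>Limits along ultrafilters\<close>

text \<open>The values stay in a compact ball, so their image filter has a cluster point. For an ultrafilter a
  cluster point is a limit: the complement of a neighborhood cannot belong to the image filter, so the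
  neighborhood does.\<close>

lemma free_ultrafilter_bounded_tendsto:
  fixes g :: "nat \<Rightarrow> 'b::{heine_borel, real_normed_vector}"
  assumes p: "free_ultrafilter p" and bd: "\<And>N. norm (g N) \<le> C"
  shows "(g \<longlongrightarrow> Lim p g) p"
proof -
  have nt: "p \<noteq> bot" and ultra: "eventually P p \<or> eventually (\<lambda>n. \<not> P n) p" for P
    using p by (auto simp: free_ultrafilter_def)
  have "eventually (\<lambda>x. x \<in> cball 0 C) (filtermap g p)"
    using bd by (simp add: eventually_filtermap)
  moreover have "filtermap g p \<noteq> bot"
    using nt by (simp add: filtermap_bot_iff)
  ultimately obtain x where x: "inf (nhds x) (filtermap g p) \<noteq> bot"
    using compact_cball[of "0::'b" C] unfolding compact_filter by blast
  have "(g \<longlongrightarrow> x) p"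
  proof (rule topological_tendstoI)
    fix T assume T: "open T" "x \<in> T"
    have "\<not> eventually (\<lambda>N. g N \<notin> T) p"
    proof
      assume "eventually (\<lambda>N. g N \<notin> T) p"
      then have "eventually (\<lambda>y. y \<notin> T) (filtermap g p)"
        by (simp add: eventually_filtermap)
      moreover have "eventually (\<lambda>y. y \<in> T) (nhds x)"
        using T by (rule eventually_nhds_in_open)
      ultimately have "eventually (\<lambda>_. False) (inf (nhds x) (filtermap g p))"
        unfolding eventually_inf by blast
      with x show False by (simp add: eventually_False)
    qed
    with ultra[of "\<lambda>N. g N \<in> T"] show "eventually (\<lambda>N. g N \<in> T) p" by blast
  qed
  then show ?thesis
    using tendsto_Lim[OF nt] by metis
qed

lemma free_ultrafilter_le_sequentially:
  assumes p: "free_ultrafilter p"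
  shows "p \<le> sequentially"
proof (rule filter_leI)
  fix P :: "nat \<Rightarrow> bool" assume "eventually P sequentially"
  then obtain k where k: "\<And>m. m \<ge> k \<Longrightarrow> P m"
    unfolding eventually_sequentially by blast
  have "\<forall>m\<in>{..<k}. eventually (\<lambda>n. n \<noteq> m) p"
    using p unfolding free_ultrafilter_def by blast
  then have "eventually (\<lambda>n. \<forall>m\<in>{..<k}. n \<noteq> m) p"
    by (intro eventually_ball_finite) auto
  then show "eventually P p"
    by (rule eventually_mono) (use k in \<open>force simp: not_less[symmetric]\<close>)
qed

section \<open>Exchanging truncated row and column sums\<close>

lemma infsum_mult_le:
  fixes u w :: "'i \<Rightarrow> 'k::{real_normed_field, banach}"
  assumes u: "(\<lambda>i. (norm (u i))\<^sup>2) summable_on A" "(\<Sum>\<^sub>\<infinity>i\<in>A. (norm (u i))\<^sup>2) \<le> \<mu>"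
    and w: "(\<lambda>i. (norm (w i))\<^sup>2) summable_on A" "(\<Sum>\<^sub>\<infinity>i\<in>A. (norm (w i))\<^sup>2) \<le> \<nu>"
  shows "(\<lambda>i. u i * w i) summable_on A"
    and "norm (\<Sum>\<^sub>\<infinity>i\<in>A. u i * w i) \<le> sqrt \<mu> * sqrt \<nu>"
proof -
  have "norm (u i * w i) \<le> (norm (u i))\<^sup>2 + (norm (w i))\<^sup>2" for i
  proof -
    have "0 \<le> norm (u i) * norm (w i)" by simp
    then show ?thesis
      using sum_squares_bound[of "norm (u i)" "norm (w i)"] unfolding norm_mult by linarith
  qed
  then have "(\<lambda>i. norm (u i * w i)) summable_on A"
    by (rule Infinite_Sum.abs_summable_on_comparison_test'[OF summable_on_add[OF u(1) w(1)]])
  then show summ: "(\<lambda>i. u i * w i) summable_on A"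
    by (rule abs_summable_summable)
  have "norm (\<Sum>i\<in>J. u i * w i) \<le> sqrt \<mu> * sqrt \<nu>" if J: "finite J" "J \<subseteq> A" for J
  proof -
    have "(\<Sum>i\<in>J. (norm (u i))\<^sup>2) \<le> \<mu>" "(\<Sum>i\<in>J. (norm (w i))\<^sup>2) \<le> \<nu>"
      using finite_sum_le_infsum[OF u(1) J] finite_sum_le_infsum[OF w(1) J] u(2) w(2) by simp_all
    then have "sqrt (\<Sum>i\<in>J. (norm (u i))\<^sup>2) * sqrt (\<Sum>i\<in>J. (norm (w i))\<^sup>2) \<le> sqrt \<mu> * sqrt \<nu>"
      by (meson mult_mono' real_sqrt_ge_zero real_sqrt_le_mono sum_nonneg zero_le_power2)
    then show ?thesis
      using norm_sum_mult_le[of u w J] by linarith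
  qed
  then have "\<forall>\<^sub>F J in finite_subsets_at_top A. norm (\<Sum>i\<in>J. u i * w i) \<le> sqrt \<mu> * sqrt \<nu>"
    by (intro eventually_finite_subsets_at_top_weakI)
  then show "norm (\<Sum>\<^sub>\<infinity>i\<in>A. u i * w i) \<le> sqrt \<mu> * sqrt \<nu>"
    using has_sum_infsum[OF summ] unfolding has_sum_def
    by (intro tendsto_upperbound[OF tendsto_norm]) auto
qed

text \<open>Used with \<open>X\<close> a box (or its preimage) and \<open>Y\<close> the concentric box shrunk by the decay radius: on \<open>Y\<close>
  decay makes the terms small, and the remaining shell is so thin that boundedness suffices.\<close>

lemma norm_sum_core_shell_le:
  fixes t :: "'b \<Rightarrow> 'c::real_normed_vector"
  assumes "finite X" "0 \<le> \<delta>"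
    and "\<And>x. x \<in> X \<Longrightarrow> norm (t x) \<le> C" "\<And>x. x \<in> X \<Longrightarrow> x \<in> Y \<Longrightarrow> norm (t x) \<le> \<delta>"
  shows "norm (\<Sum>x\<in>X. t x) \<le> \<delta> * real (card X) + C * real (card (X - Y))"
proof -
  have "(\<Sum>x\<in>X. t x) = (\<Sum>x\<in>X \<inter> Y. t x) + (\<Sum>x\<in>X - Y. t x)"
    using assms(1) by (rule sum.Int_Diff)
  then have "norm (\<Sum>x\<in>X. t x) \<le> norm (\<Sum>x\<in>X \<inter> Y. t x) + norm (\<Sum>x\<in>X - Y. t x)"
    by (simp add: norm_triangle_ineq)
  also have "norm (\<Sum>x\<in>X \<inter> Y. t x) \<le> (\<Sum>x\<in>X \<inter> Y. \<delta>)"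
    using assms by (intro sum_norm_le) auto
  also have "(\<Sum>x\<in>X \<inter> Y. \<delta>) \<le> \<delta> * real (card X)"
    using assms card_mono[of X "X \<inter> Y"] by (simp add: mult_left_mono mult.commute)
  also have "norm (\<Sum>x\<in>X - Y. t x) \<le> (\<Sum>x\<in>X - Y. C)"
    using assms by (intro sum_norm_le) auto
  finally show ?thesis by (simp add: mult.commute)
qed

context index_setting
begin

text \<open>Summing full columns over \<open>S\<^sub>N\<close> and full rows over \<open>I\<^sub>N\<close> differ only by what lies in one of the two
  strips and outside the rectangle \<open>I\<^sub>N \<times> S\<^sub>N\<close>. If \<open>j\<close> lies in the smaller box \<open>S\<^sub>N\<^sub>-\<^sub>M(c)\<close>, the indices outside
  \<open>I\<^sub>N(c)\<close> are outside \<open>I\<^sub>M(j)\<close>, so column decay controls the overhang of column \<open>j\<close>; the other columns lie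
  in a shell of relative size tending to \<open>0\<close>. Rows are symmetric, the fiber bound \<open>K\<close> transferring
  cardinalities from \<open>G\<close> to \<open>I\<close>.

  The bounds and decay hypotheses range over all subsets \<open>A\<close>, because the overhang of a column depends
  on \<open>N\<close> and \<open>c\<close> and not only on the column.\<close>

lemma truncated_sums_exchange:
  fixes m :: "'i \<Rightarrow> index \<Rightarrow> 'k::banach"
  assumes a: "a \<in> I \<rightarrow> G"
    and c: "\<And>N. c N \<in> G"
    and fiber: "\<And>j. j \<in> G \<Longrightarrow> finite {i \<in> I. a i = j}" "\<And>j. j \<in> G \<Longrightarrow> card {i \<in> I. a i = j} \<le> K"
    and summable_col: "\<And>j. j \<in> G \<Longrightarrow> (\<lambda>i. m i j) summable_on I"
    and summable_row: "\<And>i. i \<in> I \<Longrightarrow> m i summable_on G"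
    and bound_col: "\<And>j A. j \<in> G \<Longrightarrow> A \<subseteq> I \<Longrightarrow> norm (\<Sum>\<^sub>\<infinity>i\<in>A. m i j) \<le> C"
    and bound_row: "\<And>i A. i \<in> I \<Longrightarrow> A \<subseteq> G \<Longrightarrow> norm (\<Sum>\<^sub>\<infinity>j\<in>A. m i j) \<le> C"
    and decay_col: "\<And>\<delta>. \<delta> > 0 \<Longrightarrow> \<exists>M. \<forall>j\<in>G. \<forall>A\<subseteq>I - I_box d \<alpha> r n I a M j.
        norm (\<Sum>\<^sub>\<infinity>i\<in>A. m i j) \<le> \<delta>"
    and decay_row: "\<And>\<delta>. \<delta> > 0 \<Longrightarrow> \<exists>M. \<forall>i\<in>I. \<forall>A\<subseteq>G - S M (a i).
        norm (\<Sum>\<^sub>\<infinity>j\<in>A. m i j) \<le> \<delta>"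
  shows "(\<lambda>N. ((\<Sum>j\<in>S N (c N). \<Sum>\<^sub>\<infinity>i\<in>I. m i j)
      - (\<Sum>i\<in>I_box d \<alpha> r n I a N (c N). \<Sum>\<^sub>\<infinity>j\<in>G. m i j)) /\<^sub>R real (card (S N (c N)))) \<longlonglongrightarrow> 0"
proof (rule tendstoI)
  fix \<epsilon> :: real assume \<epsilon>: "\<epsilon> > 0"
  let ?I = "\<lambda>N. I_box d \<alpha> r n I a N (c N)" and ?S = "\<lambda>N. S N (c N)"
  let ?shell = "\<lambda>M N. S N (c N) - S (N - M) (c N)"
  let ?\<rho> = "\<lambda>M N. real (card (?shell M N)) / real (card (?S N))"
  have C: "0 \<le> C"
    using bound_col[OF c, of "{}"] by simp
  \<comment> \<open>The two cores together cost \<open>\<delta> (|S\<^sub>N| + |I\<^sub>N|) \<le> \<delta> (1 + K) |S\<^sub>N|\<close>, half of the allowed error.\<close>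
  define \<delta> where "\<delta> = \<epsilon> / (2 * (1 + real K))"
  have \<delta>: "\<delta> > 0" using \<epsilon> by (simp add: \<delta>_def)
  obtain M1 where M1: "\<And>j A. j \<in> G \<Longrightarrow> A \<subseteq> I - I_box d \<alpha> r n I a M1 j \<Longrightarrow> norm (\<Sum>\<^sub>\<infinity>i\<in>A. m i j) \<le> \<delta>"
    using decay_col[OF \<delta>] by blast
  obtain M2 where M2: "\<And>i A. i \<in> I \<Longrightarrow> A \<subseteq> G - S M2 (a i) \<Longrightarrow> norm (\<Sum>\<^sub>\<infinity>j\<in>A. m i j) \<le> \<delta>"
    using decay_row[OF \<delta>] by blast
  have "(\<lambda>N. C * ?\<rho> M1 N + C * real K * ?\<rho> M2 N) \<longlonglongrightarrow> C * 0 + C * real K * 0"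
    by (intro tendsto_intros shell_ratio_tendsto_0 c)
  then have "\<forall>\<^sub>F N in sequentially. C * ?\<rho> M1 N + C * real K * ?\<rho> M2 N < \<epsilon> / 2"
    using \<epsilon> by (intro order_tendstoD(2)) auto
  then show "\<forall>\<^sub>F N in sequentially. dist (((\<Sum>j\<in>?S N. \<Sum>\<^sub>\<infinity>i\<in>I. m i j)
      - (\<Sum>i\<in>?I N. \<Sum>\<^sub>\<infinity>j\<in>G. m i j)) /\<^sub>R real (card (?S N))) 0 < \<epsilon>"
    using eventually_ge_at_top[of "max M1 M2"]
  proof eventually_elim
    case (elim N)
    have S: "finite (?S N)" "card (?S N) > 0" "?S N \<subseteq> G"
      using S_box_card(1)[OF c] S_box_card_pos[OF c] S_box_subset by blast+
    have preimage: "finite {i \<in> I. a i \<in> X} \<and> card {i \<in> I. a i \<in> X} \<le> K * card X" if "X \<subseteq> ?S N" for X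
      using card_preimage_le[of X I a K] finite_subset[OF that S(1)] that S(3) fiber
      by (meson subset_iff)
    have I: "finite (?I N)" "card (?I N) \<le> K * card (?S N)" "?I N \<subseteq> I"
      using preimage[of "?S N"] by (auto simp: I_box_def)
    \<comment> \<open>The part of the matrix over \<open>I\<^sub>N \<times> S\<^sub>N\<close> is common to both sums and cancels.\<close>
    have cols: "(\<Sum>\<^sub>\<infinity>i\<in>I. m i j) = (\<Sum>i\<in>?I N. m i j) + (\<Sum>\<^sub>\<infinity>i\<in>I - ?I N. m i j)" if "j \<in> ?S N" for j
    proof -
      have j: "(\<lambda>i. m i j) summable_on I - ?I N"
        using summable_col[of j] that S(3) by (auto intro: summable_on_subset_banach)
      show ?thesis
        using infsum_Un_disjoint[OF summable_on_finite[OF I(1)] j] I(1,3) by (simp add: Un_absorb1)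
    qed
    have rows: "(\<Sum>\<^sub>\<infinity>j\<in>G. m i j) = (\<Sum>j\<in>?S N. m i j) + (\<Sum>\<^sub>\<infinity>j\<in>G - ?S N. m i j)" if "i \<in> ?I N" for i
    proof -
      have i: "m i summable_on G - ?S N"
        using summable_row[of i] that I(3) by (auto intro: summable_on_subset_banach)
      show ?thesis
        using infsum_Un_disjoint[OF summable_on_finite[OF S(1)] i] S(1,3) by (simp add: Un_absorb1)
    qed
    have "(\<Sum>j\<in>?S N. \<Sum>\<^sub>\<infinity>i\<in>I. m i j) - (\<Sum>i\<in>?I N. \<Sum>\<^sub>\<infinity>j\<in>G. m i j) =
        (\<Sum>j\<in>?S N. \<Sum>\<^sub>\<infinity>i\<in>I - ?I N. m i j) - (\<Sum>i\<in>?I N. \<Sum>\<^sub>\<infinity>j\<in>G - ?S N. m i j)"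
      using sum.swap[of m "?S N" "?I N"] by (simp add: cols rows sum.distrib)
    then have "norm ((\<Sum>j\<in>?S N. \<Sum>\<^sub>\<infinity>i\<in>I. m i j) - (\<Sum>i\<in>?I N. \<Sum>\<^sub>\<infinity>j\<in>G. m i j)) \<le>
        norm (\<Sum>j\<in>?S N. \<Sum>\<^sub>\<infinity>i\<in>I - ?I N. m i j) + norm (\<Sum>i\<in>?I N. \<Sum>\<^sub>\<infinity>j\<in>G - ?S N. m i j)"
      by (simp add: norm_triangle_ineq4)
    also have "norm (\<Sum>j\<in>?S N. \<Sum>\<^sub>\<infinity>i\<in>I - ?I N. m i j) \<le>
        \<delta> * real (card (?S N)) + C * real (card (?shell M1 N))"
    proof (rule norm_sum_core_shell_le[OF S(1)])
      fix j assume j: "j \<in> ?S N" "j \<in> S (N - M1) (c N)"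
      have "S M1 j \<subseteq> ?S N"
        using elim j(2) by (intro S_box_nested c) auto
      then have "I_box d \<alpha> r n I a M1 j \<subseteq> ?I N"
        by (auto simp: I_box_def)
      then show "norm (\<Sum>\<^sub>\<infinity>i\<in>I - ?I N. m i j) \<le> \<delta>"
        using j(1) S(3) by (intro M1) auto
    qed (use \<delta> S(3) in \<open>auto intro: bound_col\<close>)
    also have "norm (\<Sum>i\<in>?I N. \<Sum>\<^sub>\<infinity>j\<in>G - ?S N. m i j) \<le>
        \<delta> * real (card (?I N)) + C * real (card (?I N - {i. a i \<in> S (N - M2) (c N)}))"
    proof (rule norm_sum_core_shell_le[OF I(1)])
      fix i assume i: "i \<in> ?I N" "i \<in> {i. a i \<in> S (N - M2) (c N)}"
      have "S M2 (a i) \<subseteq> ?S N"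
        using elim i(2) by (intro S_box_nested c) auto
      then show "norm (\<Sum>\<^sub>\<infinity>j\<in>G - ?S N. m i j) \<le> \<delta>"
        using i(1) I(3) by (intro M2) auto
    qed (use \<delta> I(3) in \<open>auto intro: bound_row\<close>)
    also have "?I N - {i. a i \<in> S (N - M2) (c N)} = {i \<in> I. a i \<in> ?shell M2 N}"
      by (auto simp: I_box_def)
    also have "\<delta> * real (card (?S N)) + C * real (card (?shell M1 N)) +
        (\<delta> * real (card (?I N)) + C * real (card {i \<in> I. a i \<in> ?shell M2 N})) \<le>
        \<delta> * real (card (?S N)) + C * real (card (?shell M1 N)) +
        (\<delta> * (real K * real (card (?S N))) + C * (real K * real (card (?shell M2 N))))"
      using \<delta> C I(2) preimage[of "?shell M2 N"]
      by (intro add_mono mult_left_mono order_refl) (auto simp flip: of_nat_mult)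
    also have "\<dots> = (\<epsilon> / 2 + (C * ?\<rho> M1 N + C * real K * ?\<rho> M2 N)) * real (card (?S N))"
    proof -
      let ?s = "real (card (?S N))"
      have half: "\<epsilon> / 2 = \<delta> * (1 + real K)" by (simp add: \<delta>_def field_simps)
      have \<rho>: "real (card (?shell M N)) = ?\<rho> M N * ?s" for M :: nat
        using S(2) by simp
      have "\<delta> * ?s + C * (x * ?s) + (\<delta> * (real K * ?s) + C * (real K * (y * ?s))) =
          (\<delta> * (1 + real K) + (C * x + C * real K * y)) * ?s" for x y
        by (simp only: algebra_simps)
      from this[of "?\<rho> M1 N" "?\<rho> M2 N"] show ?thesis
        by (simp only: half \<rho>[symmetric])
    qed
    also have "\<dots> < \<epsilon> * real (card (?S N))"
    proof (rule mult_strict_right_mono)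
      show "\<epsilon> / 2 + (C * ?\<rho> M1 N + C * real K * ?\<rho> M2 N) < \<epsilon>"
        using elim(1) by linarith
    qed (use S(2) in simp)
    finally have "norm ((\<Sum>j\<in>?S N. \<Sum>\<^sub>\<infinity>i\<in>I. m i j) - (\<Sum>i\<in>?I N. \<Sum>\<^sub>\<infinity>j\<in>G. m i j)) / real (card (?S N)) < \<epsilon>"
      using S(2) by (subst pos_divide_less_eq) auto
    then show ?case
      by (simp add: dist_norm divide_inverse mult.commute)
  qed
qed

end

section \<open>Comparing the relative measures\<close>

lemma norm_average_le:
  fixes u :: "'b \<Rightarrow> 'k::real_or_complex"
  assumes "\<And>x. x \<in> A \<Longrightarrow> norm (u x) \<le> C" "0 \<le> C"
  shows "norm (average A u) \<le> C"
proof (cases "card A = 0")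
  case False
  have "norm (\<Sum>x\<in>A. u x) \<le> real (card A) * C"
    using sum_norm_bound[of A u C] assms(1) by simp
  with False show ?thesis
    by (simp add: average_def norm_mult norm_divide field_simps)
qed (use assms in \<open>simp add: average_def\<close>)

theorem theorem3p4:
  fixes smul :: "'k::real_or_complex \<Rightarrow> 'h::banach \<Rightarrow> 'h"
    and ip :: "'h \<Rightarrow> 'h \<Rightarrow> 'k"
    and d r :: nat and \<alpha> :: "nat \<Rightarrow> real" and n :: "nat \<Rightarrow> nat"
    and I :: "'i set" and a :: "'i \<Rightarrow> index"
    and f :: "'i \<Rightarrow> 'h" and e :: "index \<Rightarrow> 'h"
  assumes hilbert: "hilbert_space smul ip"
    and separable: "\<exists>D::'h set. countable D \<and> closure D = UNIV"
    and d_pos: "d \<ge> 1"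
    and \<alpha>_pos: "\<And>i. i \<in> {1..d} \<Longrightarrow> \<alpha> i > 0"
    and n_pos: "\<And>j. j \<in> {1..r} \<Longrightarrow> n j > 0"
    and I_countable: "countable I"
    and a_map: "a \<in> I \<rightarrow> carrier (index_group d \<alpha> r n)"
    and frame_F: "frame_sequence smul ip I f"
    and frame_E: "frame_sequence smul ip (carrier (index_group d \<alpha> r n)) e"
    and density: "upper_density d \<alpha> r n I a < \<infinity>"
    and column: "column_decay ip d \<alpha> r n I a f e"
    and row: "row_decay ip d \<alpha> r n I a f e"
  shows "(\<forall>c. (\<forall>N. c N \<in> carrier (index_group d \<alpha> r n)) \<longrightarrow>
      (\<lambda>N. avg_measure_F smul ip d \<alpha> r n I f e N (c N)
           - of_real (density_ratio d \<alpha> r n I a N (c N))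
             * avg_measure_E smul ip d \<alpha> r n I a f e N (c N))
      \<longlonglongrightarrow> 0) \<and>
    (\<forall>c p. (\<forall>N. c N \<in> carrier (index_group d \<alpha> r n)) \<longrightarrow> free_ultrafilter p \<longrightarrow>
      rel_measure_F smul ip d \<alpha> r n I f e p c
      = of_real (ultra_density d \<alpha> r n I a p c) * rel_measure_E smul ip d \<alpha> r n I a f e p c)"
proof -
  interpret hilbert_space smul ip by (rule hilbert)
  interpret index_setting d r \<alpha> n by unfold_locales (fact d_pos \<alpha>_pos n_pos)+
  let ?I = "I_box d \<alpha> r n I a"
  let ?f' = "canonical_dual smul ip I f" and ?e' = "canonical_dual smul ip G e"
  let ?PF = "orth_proj ip (closed_span smul I f)" and ?PE = "orth_proj ip (closed_span smul G e)"
  define u where "u = (\<lambda>i j. ip (f i) (e j))"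
  define w where "w = (\<lambda>i j. ip (?e' j) (?f' i))"
  obtain K where fiber: "\<And>j. j \<in> G \<Longrightarrow> finite {i \<in> I. a i = j}" "\<And>j. j \<in> G \<Longrightarrow> card {i \<in> I. a i = j} \<le> K"
    using upper_density_finite_fibers[OF density] by blast
  obtain L where L: "analysis_bound I f L" "analysis_bound I ?f' L" "analysis_bound G e L" "analysis_bound G ?e' L"
  proof -
    obtain L1 L2 L3 L4 where "analysis_bound I f L1" "analysis_bound I ?f' L2" "analysis_bound G e L3"
        "analysis_bound G ?e' L4"
      using frame_sequence_imp_bessel[OF frame_F] frame_sequence_imp_bessel[OF frame_E]
        canonical_dual_analysis_bound[OF frame_F] canonical_dual_analysis_bound[OF frame_E]
        bessel_imp_analysis_bound by metis
    then show ?thesis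
      by (intro that[of "max (max L1 L2) (max L3 L4)"]) (auto elim: analysis_bound_mono)
  qed
  have L0: "L > 0" using L(1) by (simp add: analysis_bound_def)
  have bnd: "(\<lambda>x. (norm (ip (h y) (g x)))\<^sup>2) summable_on X \<and>
      (\<Sum>\<^sub>\<infinity>x\<in>X. (norm (ip (h y) (g x)))\<^sup>2) \<le> L\<^sup>2"
    if "analysis_bound X g L" "analysis_bound Y h L" "y \<in> Y"
    for X :: "'x set" and Y :: "'y set" and g h y
  proof -
    have "L * (norm (h y))\<^sup>2 \<le> L * L"
      using analysis_bound_norm[OF that(2,3)] L0 by (intro mult_left_mono) auto
    then show ?thesis
      using that(1) unfolding analysis_bound_def power2_eq_square[of L] by (meson order_trans)
  qed
  have u_col: "(\<lambda>i. (norm (u i j))\<^sup>2) summable_on I" "(\<Sum>\<^sub>\<infinity>i\<in>I. (norm (u i j))\<^sup>2) \<le> L\<^sup>2" if "j \<in> G" for j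
    using bnd[OF L(1,3) that] by (simp_all add: u_def norm_ip_commute[of "f _"])
  have w_col: "(\<lambda>i. (norm (w i j))\<^sup>2) summable_on I" "(\<Sum>\<^sub>\<infinity>i\<in>I. (norm (w i j))\<^sup>2) \<le> L\<^sup>2" if "j \<in> G" for j
    using bnd[OF L(2,4) that] by (simp_all add: w_def)
  have u_row: "(\<lambda>j. (norm (u i j))\<^sup>2) summable_on G" "(\<Sum>\<^sub>\<infinity>j\<in>G. (norm (u i j))\<^sup>2) \<le> L\<^sup>2" if "i \<in> I" for i
    using bnd[OF L(3,1) that] by (simp_all add: u_def)
  have w_row: "(\<lambda>j. (norm (w i j))\<^sup>2) summable_on G" "(\<Sum>\<^sub>\<infinity>j\<in>G. (norm (w i j))\<^sup>2) \<le> L\<^sup>2" if "i \<in> I" for i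
    using bnd[OF L(4,2) that] by (simp_all add: w_def norm_ip_commute[of "?e' _"])
  \<comment> \<open>The projection terms of both averages are the column sums and the row sums of \<open>u i j * w i j\<close>.\<close>
  have PF: "ip (?PF (?e' j)) (e j) = (\<Sum>\<^sub>\<infinity>i\<in>I. u i j * w i j)" for j
    using canonical_dual_expansion[OF frame_F, of "?e' j" "e j"]
    by (intro infsumI[symmetric]) (simp add: u_def w_def mult.commute)
  have PE: "ip (?PE (f i)) (?f' i) = (\<Sum>\<^sub>\<infinity>j\<in>G. u i j * w i j)" for i
    using canonical_dual_expansion'[OF frame_E, of "f i" "?f' i"]
    by (intro infsumI[symmetric]) (simp add: u_def w_def)
  have part: "(\<lambda>x. (norm (g x))\<^sup>2) summable_on A \<and> (\<Sum>\<^sub>\<infinity>x\<in>A. (norm (g x))\<^sup>2) \<le> b"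
    if "(\<lambda>x. (norm (g x))\<^sup>2) summable_on X" "(\<Sum>\<^sub>\<infinity>x\<in>X. (norm (g x))\<^sup>2) \<le> b" "A \<subseteq> X"
    for g :: "'x \<Rightarrow> 'k" and A X b
  proof -
    have *: "(\<lambda>x. (norm (g x))\<^sup>2) summable_on A"
      using that by (auto intro: summable_on_subset_banach)
    have "(\<Sum>\<^sub>\<infinity>x\<in>A. (norm (g x))\<^sup>2) \<le> (\<Sum>\<^sub>\<infinity>x\<in>X. (norm (g x))\<^sup>2)"
      using * that by (intro infsum_mono_neutral) auto
    with * that show ?thesis by simp
  qed
  have sqrtL: "sqrt (L\<^sup>2) = L" using L0 by simp
  have bound_col: "norm (\<Sum>\<^sub>\<infinity>i\<in>A. u i j * w i j) \<le> L\<^sup>2" if "j \<in> G" "A \<subseteq> I" for j A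
    using infsum_mult_le(2)[of "\<lambda>i. u i j" A "L\<^sup>2" "\<lambda>i. w i j" "L\<^sup>2"]
      part[OF u_col[OF that(1)] that(2)] part[OF w_col[OF that(1)] that(2)]
    by (simp add: sqrtL power2_eq_square)
  have bound_row: "norm (\<Sum>\<^sub>\<infinity>j\<in>A. u i j * w i j) \<le> L\<^sup>2" if "i \<in> I" "A \<subseteq> G" for i A
    using infsum_mult_le(2)[of "u i" A "L\<^sup>2" "w i" "L\<^sup>2"]
      part[OF u_row[OF that(1)] that(2)] part[OF w_row[OF that(1)] that(2)]
    by (simp add: sqrtL power2_eq_square)
  have decay_col: "\<exists>M. \<forall>j\<in>G. \<forall>A\<subseteq>I - ?I M j. norm (\<Sum>\<^sub>\<infinity>i\<in>A. u i j * w i j) \<le> \<delta>" if \<delta>: "\<delta> > 0" for \<delta>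
  proof -
    \<comment> \<open>By Cauchy--Schwarz the tail is at most \<open>(\<delta> / L) * L\<close>, where \<open>L\<^sup>2\<close> bounds the square sum of \<open>w\<close>.\<close>
    have "(\<delta> / L)\<^sup>2 > 0" using \<delta> L0 by simp
    then obtain M where M: "\<forall>j\<in>G. (\<lambda>i. (norm (u i j))\<^sup>2) summable_on (I - ?I M j) \<and>
        (\<Sum>\<^sub>\<infinity>i\<in>I - ?I M j. (norm (u i j))\<^sup>2) < (\<delta> / L)\<^sup>2"
      using column unfolding column_decay_def u_def by blast
    have "norm (\<Sum>\<^sub>\<infinity>i\<in>A. u i j * w i j) \<le> \<delta>" if j: "j \<in> G" and A: "A \<subseteq> I - ?I M j" for j A
    proof -
      have "A \<subseteq> I" using A by blast
      then have "norm (\<Sum>\<^sub>\<infinity>i\<in>A. u i j * w i j) \<le> sqrt ((\<delta> / L)\<^sup>2) * sqrt (L\<^sup>2)"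
        using part[of "\<lambda>i. u i j" "I - ?I M j" "(\<delta> / L)\<^sup>2" A] part[OF w_col[OF j], of A] M j A
        by (intro infsum_mult_le(2)) auto
      then show ?thesis using \<delta> L0 by simp
    qed
    then show ?thesis by blast
  qed
  have decay_row: "\<exists>M. \<forall>i\<in>I. \<forall>A\<subseteq>G - S M (a i). norm (\<Sum>\<^sub>\<infinity>j\<in>A. u i j * w i j) \<le> \<delta>" if \<delta>: "\<delta> > 0" for \<delta>
  proof -
    have "(\<delta> / L)\<^sup>2 > 0" using \<delta> L0 by simp
    then obtain M where M: "\<forall>i\<in>I. (\<lambda>j. (norm (u i j))\<^sup>2) summable_on (G - S M (a i)) \<and>
        (\<Sum>\<^sub>\<infinity>j\<in>G - S M (a i). (norm (u i j))\<^sup>2) < (\<delta> / L)\<^sup>2"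
      using row unfolding row_decay_def u_def by blast
    have "norm (\<Sum>\<^sub>\<infinity>j\<in>A. u i j * w i j) \<le> \<delta>" if i: "i \<in> I" and A: "A \<subseteq> G - S M (a i)" for i A
    proof -
      have "A \<subseteq> G" using A by blast
      then have "norm (\<Sum>\<^sub>\<infinity>j\<in>A. u i j * w i j) \<le> sqrt ((\<delta> / L)\<^sup>2) * sqrt (L\<^sup>2)"
        using part[of "u i" "G - S M (a i)" "(\<delta> / L)\<^sup>2" A] part[OF w_row[OF i], of A] M i A
        by (intro infsum_mult_le(2)) auto
      then show ?thesis using \<delta> L0 by simp
    qed
    then show ?thesis by blast
  qed
  have I_fin: "finite (?I N j)" "card (?I N j) \<le> K * card (S N j)" if "j \<in> G" for N j
    unfolding I_box_def using that S_box_subset fiber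
    by (intro card_preimage_le S_box_card(1); blast)+
  have lim: "(\<lambda>N. avg_measure_F smul ip d \<alpha> r n I f e N (c N)
      - of_real (density_ratio d \<alpha> r n I a N (c N)) * avg_measure_E smul ip d \<alpha> r n I a f e N (c N))
      \<longlonglongrightarrow> 0" if c: "\<And>N. c N \<in> G" for c
  proof -
    have "avg_measure_F smul ip d \<alpha> r n I f e N (c N)
      - of_real (density_ratio d \<alpha> r n I a N (c N)) * avg_measure_E smul ip d \<alpha> r n I a f e N (c N)
      = ((\<Sum>j\<in>S N (c N). \<Sum>\<^sub>\<infinity>i\<in>I. u i j * w i j)
      - (\<Sum>i\<in>?I N (c N). \<Sum>\<^sub>\<infinity>j\<in>G. u i j * w i j)) /\<^sub>R real (card (S N (c N)))" for N
      using I_fin(1)[OF c, of N N]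
      \<comment> \<open>For empty \<open>I\<^sub>N\<close> both the density ratio and the average are \<open>0\<close>.\<close>
      by (cases "?I N (c N) = {}")
        (auto simp: avg_measure_F_def avg_measure_E_def average_def density_ratio_def PF PE
          scaleR_conv_of_real divide_inverse right_diff_distrib)
    moreover have "(\<lambda>N. ((\<Sum>j\<in>S N (c N). \<Sum>\<^sub>\<infinity>i\<in>I. u i j * w i j)
      - (\<Sum>i\<in>?I N (c N). \<Sum>\<^sub>\<infinity>j\<in>G. u i j * w i j)) /\<^sub>R real (card (S N (c N)))) \<longlonglongrightarrow> 0"
      using infsum_mult_le(1)[OF u_col w_col] infsum_mult_le(1)[OF u_row w_row]
      by (intro truncated_sums_exchange[OF a_map c fiber _ _ bound_col bound_row decay_col decay_row])
    ultimately show ?thesis by simp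
  qed
  have "rel_measure_F smul ip d \<alpha> r n I f e p c
      = of_real (ultra_density d \<alpha> r n I a p c) * rel_measure_E smul ip d \<alpha> r n I a f e p c"
    if c: "\<And>N. c N \<in> G" and p: "free_ultrafilter p" for c p
  proof -
    have "norm (avg_measure_F smul ip d \<alpha> r n I f e N (c N)) \<le> L\<^sup>2" for N
      unfolding avg_measure_F_def PF by (intro norm_average_le bound_col subsetD[OF S_box_subset]) auto
    then have F: "((\<lambda>N. avg_measure_F smul ip d \<alpha> r n I f e N (c N)) \<longlongrightarrow> rel_measure_F smul ip d \<alpha> r n I f e p c) p"
      unfolding rel_measure_F_def by (rule free_ultrafilter_bounded_tendsto[OF p])
    have "norm (avg_measure_E smul ip d \<alpha> r n I a f e N (c N)) \<le> L\<^sup>2" for N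
      unfolding avg_measure_E_def PE using bound_row by (intro norm_average_le) (auto simp: I_box_def)
    then have E: "((\<lambda>N. avg_measure_E smul ip d \<alpha> r n I a f e N (c N)) \<longlongrightarrow> rel_measure_E smul ip d \<alpha> r n I a f e p c) p"
      unfolding rel_measure_E_def by (rule free_ultrafilter_bounded_tendsto[OF p])
    have "norm (density_ratio d \<alpha> r n I a N (c N)) \<le> real K" for N
      using I_fin(2)[OF c, of N N] S_box_card_pos[OF c, of N N]
      by (simp add: density_ratio_def divide_le_eq flip: of_nat_mult)
    then have D: "((\<lambda>N. density_ratio d \<alpha> r n I a N (c N)) \<longlongrightarrow> ultra_density d \<alpha> r n I a p c) p"
      unfolding ultra_density_def by (rule free_ultrafilter_bounded_tendsto[OF p])
    have "rel_measure_F smul ip d \<alpha> r n I f e p c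
      - of_real (ultra_density d \<alpha> r n I a p c) * rel_measure_E smul ip d \<alpha> r n I a f e p c = 0"
    proof (rule tendsto_unique)
      show "p \<noteq> bot" using p by (simp add: free_ultrafilter_def)
      show "((\<lambda>N. avg_measure_F smul ip d \<alpha> r n I f e N (c N)
        - of_real (density_ratio d \<alpha> r n I a N (c N)) * avg_measure_E smul ip d \<alpha> r n I a f e N (c N))
        \<longlongrightarrow> rel_measure_F smul ip d \<alpha> r n I f e p c
        - of_real (ultra_density d \<alpha> r n I a p c) * rel_measure_E smul ip d \<alpha> r n I a f e p c) p"
        by (intro tendsto_diff tendsto_mult tendsto_of_real F E D)
      show "((\<lambda>N. avg_measure_F smul ip d \<alpha> r n I f e N (c N)
        - of_real (density_ratio d \<alpha> r n I a N (c N)) * avg_measure_E smul ip d \<alpha> r n I a f e N (c N))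
        \<longlongrightarrow> 0) p"
        using lim[OF c] free_ultrafilter_le_sequentially[OF p] by (rule tendsto_mono[rotated])
    qed
    then show ?thesis by simp
  qed
  with lim show ?thesis by blast
qed

end
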